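(* Let $x_1,\dots,x_n$ be variable tuples, and let $\mu_i\in\mathfrak M_{x_i}(M)$ be Keisler measures for $1\le i\le n$. The measures $\mu_1,\dots,\mu_n$ are weakly orthogonal if and only if for every $M$-definable predicate $\phi(x_1,\dots,x_n)$ and every $\varepsilon>0$ there exist $M$-definable predicates $\psi^-(x_1,\dots,x_n)$ and $\psi^+(x_1,\dots,x_n)$, each of the form $\psi^{\pm}(x_1,\dots,x_n)=\sum_{j=1}^m\prod_{i=1}^n\theta^{\pm}_{ij}(x_i)$ with the $\theta^\pm_{ij}(x_i)$ $M$-definable predicates, such that: (1) for all $(x_1,\dots,x_n)$, $\psi^-(x_1,\dots,x_n)\le\phi(x_1,\dots,x_n)\le\psi^+(x_1,\dots,x_n)$; (2) for any product measure $\omega$ of $\mu_1,\dots,\mu_n$, $\int_{S_{x_1\dots x_n}(M)}(\psi^+-\psi^-)\,d\omega\le\varepsilon$.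
   Context: $T$ is a complete theory of metric structures in ($[0,1]$-valued) continuous first-order logic and $M\models T$. $S_x(M)$ is the compact Hausdorff space of complete types over $M$ in the variable tuple $x$. An $M$-definable predicate in $x$ is a continuous function on $S_x(M)$ (equivalently a uniform limit of formulas with parameters in $M$), evaluated at a tuple $a$ by evaluating at $\mathrm{tp}(a/M)$; values are conventionally in $[0,1]$, but real-valued continuous functions (e.g. linear combinations) are also used. A Keisler measure on $S_x(M)$ is a regular Borel probability measure on $S_x(M)$; $\mathfrak M_x(M)$ is the set of these, in bijection with positive linear functionals $f$ on $\mathcal C(S_x(M),\mathbb R)$ with $f(1)=1$. Given $\mu_i\in\mathfrak M_{x_i}(M)$, a measure $\omega\in\mathfrak M_{x_1\dots x_n}(M)$ is a product measure of $\mu_1,\dots,\mu_n$ if $\int\prod_{i=1}^n\psi_i(x_i)\,d\omega=\prod_{i=1}^n\int_{S_{x_i}(M)}\psi_i(x_i)\,d\mu_i$ for all $M$-definable predicates $\psi_i(x_i)$. The measures $\mu_1,\dots,\mu_n$ are weakly orthogonal if they have a unique product measure. *)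

theory Defs
  imports "HOL-Probability.Probability"
begin

section \<open>Metric structures and continuous first-order logic\<close>

text \<open>
  Many-sorted signatures. A symbol comes with its list of argument sorts and a modulus of
  uniform continuity; constants are function symbols with no arguments.
\<close>

record ('f, 'p, 'v, 's) language =
  fdom :: "'f \<Rightarrow> 's list"
  fcod :: "'f \<Rightarrow> 's"
  fmodulus :: "'f \<Rightarrow> real \<Rightarrow> real"
  pdom :: "'p \<Rightarrow> 's list"
  pmodulus :: "'p \<Rightarrow> real \<Rightarrow> real"
  vsort :: "'v \<Rightarrow> 's"

definition wf_language :: "('f, 'p, 'v, 's) language \<Rightarrow> bool" where
  "wf_language L \<longleftrightarrow>
     (\<forall>f e. 0 < e \<and> e \<le> 1 \<longrightarrow> 0 < fmodulus L f e) \<and>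
     (\<forall>P e. 0 < e \<and> e \<le> 1 \<longrightarrow> 0 < pmodulus L P e) \<and>
     (\<forall>s. infinite {v. vsort L v = s})"

record ('f, 'p, 's, 'm) mstruct =
  univ :: "'s \<Rightarrow> 'm set"
  mdist :: "'s \<Rightarrow> 'm \<Rightarrow> 'm \<Rightarrow> real"
  fint :: "'f \<Rightarrow> 'm list \<Rightarrow> 'm"
  pint :: "'p \<Rightarrow> 'm list \<Rightarrow> real"

definition args :: "('f, 'p, 's, 'm) mstruct \<Rightarrow> 's list \<Rightarrow> 'm list set" where
  "args M ss = {xs. list_all2 (\<lambda>x s. x \<in> univ M s) xs ss}"

definition close_args ::
  "('f, 'p, 's, 'm) mstruct \<Rightarrow> 's list \<Rightarrow> real \<Rightarrow> 'm list \<Rightarrow> 'm list \<Rightarrow> bool" where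
  "close_args M ss d xs ys \<longleftrightarrow> (\<forall>i<length ss. mdist M (ss ! i) (xs ! i) (ys ! i) < d)"

definition metric_structure ::
  "('f, 'p, 'v, 's) language \<Rightarrow> ('f, 'p, 's, 'm) mstruct \<Rightarrow> bool" where
  "metric_structure L M \<longleftrightarrow>
     (\<forall>s. univ M s \<noteq> {} \<and> Metric_space (univ M s) (mdist M s) \<and>
          Metric_space.mcomplete (univ M s) (mdist M s) \<and>
          (\<forall>x\<in>univ M s. \<forall>y\<in>univ M s. mdist M s x y \<le> 1)) \<and>
     (\<forall>f. (\<forall>xs\<in>args M (fdom L f). fint M f xs \<in> univ M (fcod L f)) \<and>
          (\<forall>e. 0 < e \<and> e \<le> 1 \<longrightarrow>
             (\<forall>xs\<in>args M (fdom L f). \<forall>ys\<in>args M (fdom L f).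
                close_args M (fdom L f) (fmodulus L f e) xs ys \<longrightarrow>
                mdist M (fcod L f) (fint M f xs) (fint M f ys) \<le> e))) \<and>
     (\<forall>P. (\<forall>xs\<in>args M (pdom L P). pint M P xs \<in> {0..1}) \<and>
          (\<forall>e. 0 < e \<and> e \<le> 1 \<longrightarrow>
             (\<forall>xs\<in>args M (pdom L P). \<forall>ys\<in>args M (pdom L P).
                close_args M (pdom L P) (pmodulus L P e) xs ys \<longrightarrow>
                \<bar>pint M P xs - pint M P ys\<bar> \<le> e)))"

text \<open>
  \<open>Par s m\<close> is the constant naming the parameter \<open>m\<close> of sort \<open>s\<close>. \<open>SupQ v \<phi>\<close> and \<open>InfQ v \<phi>\<close>
  are the quantifiers of continuous logic, and \<open>Conn u [\<phi>\<^sub>1, \<dots>, \<phi>\<^sub>k]\<close> applies a connective, which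
  in a well-formed formula is a continuous function \<open>[0,1]\<^sup>k \<rightarrow> [0,1]\<close>.
\<close>

datatype ('f, 'v, 's, 'm) tm = Var 'v | Par 's 'm | Fn 'f "('f, 'v, 's, 'm) tm list"

datatype ('f, 'p, 'v, 's, 'm) fm =
    Dist 's "('f, 'v, 's, 'm) tm" "('f, 'v, 's, 'm) tm"
  | Pred 'p "('f, 'v, 's, 'm) tm list"
  | Conn "real list \<Rightarrow> real" "('f, 'p, 'v, 's, 'm) fm list"
  | SupQ 'v "('f, 'p, 'v, 's, 'm) fm"
  | InfQ 'v "('f, 'p, 'v, 's, 'm) fm"

definition cube :: "nat \<Rightarrow> real list set" where
  "cube k = {xs. length xs = k \<and> set xs \<subseteq> {0..1}}"

definition connective :: "nat \<Rightarrow> (real list \<Rightarrow> real) \<Rightarrow> bool" where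
  "connective k u \<longleftrightarrow>
     u ` cube k \<subseteq> {0..1} \<and>
     (\<forall>xs\<in>cube k. \<forall>e>0. \<exists>d>0. \<forall>ys\<in>cube k.
        (\<forall>i<k. \<bar>xs ! i - ys ! i\<bar> < d) \<longrightarrow> \<bar>u xs - u ys\<bar> < e)"

text \<open>Terms and formulas over a set \<open>A\<close> of parameters (\<open>A s\<close> being those of sort \<open>s\<close>).\<close>

inductive wf_tm ::
  "('f, 'p, 'v, 's) language \<Rightarrow> ('s \<Rightarrow> 'm set) \<Rightarrow> ('f, 'v, 's, 'm) tm \<Rightarrow> 's \<Rightarrow> bool"
  for L :: "('f, 'p, 'v, 's) language" and A :: "'s \<Rightarrow> 'm set" where
  "vsort L v = s \<Longrightarrow> wf_tm L A (Var v) s"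
| "m \<in> A s \<Longrightarrow> wf_tm L A (Par s m) s"
| "list_all2 (wf_tm L A) ts (fdom L f) \<Longrightarrow> fcod L f = s \<Longrightarrow> wf_tm L A (Fn f ts) s"

inductive wf_fm ::
  "('f, 'p, 'v, 's) language \<Rightarrow> ('s \<Rightarrow> 'm set) \<Rightarrow> ('f, 'p, 'v, 's, 'm) fm \<Rightarrow> bool"
  for L :: "('f, 'p, 'v, 's) language" and A :: "'s \<Rightarrow> 'm set" where
  "wf_tm L A t s \<Longrightarrow> wf_tm L A u s \<Longrightarrow> wf_fm L A (Dist s t u)"
| "list_all2 (wf_tm L A) ts (pdom L P) \<Longrightarrow> wf_fm L A (Pred P ts)"
| "connective (length \<phi>s) u \<Longrightarrow> list_all (wf_fm L A) \<phi>s \<Longrightarrow> wf_fm L A (Conn u \<phi>s)"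
| "wf_fm L A \<phi> \<Longrightarrow> wf_fm L A (SupQ v \<phi>)"
| "wf_fm L A \<phi> \<Longrightarrow> wf_fm L A (InfQ v \<phi>)"

primrec fv_tm :: "('f, 'v, 's, 'm) tm \<Rightarrow> 'v set" where
  "fv_tm (Var v) = {v}"
| "fv_tm (Par s m) = {}"
| "fv_tm (Fn f ts) = \<Union> (set (map fv_tm ts))"

primrec fv :: "('f, 'p, 'v, 's, 'm) fm \<Rightarrow> 'v set" where
  "fv (Dist s t u) = fv_tm t \<union> fv_tm u"
| "fv (Pred P ts) = \<Union> (set (map fv_tm ts))"
| "fv (Conn u \<phi>s) = \<Union> (set (map fv \<phi>s))"
| "fv (SupQ v \<phi>) = fv \<phi> - {v}"
| "fv (InfQ v \<phi>) = fv \<phi> - {v}"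

primrec tval :: "('f, 'p, 's, 'm) mstruct \<Rightarrow> ('v \<Rightarrow> 'm) \<Rightarrow> ('f, 'v, 's, 'm) tm \<Rightarrow> 'm" where
  "tval M a (Var v) = a v"
| "tval M a (Par s m) = m"
| "tval M a (Fn f ts) = fint M f (map (tval M a) ts)"

primrec fval ::
  "('f, 'p, 'v, 's) language \<Rightarrow> ('f, 'p, 's, 'm) mstruct \<Rightarrow>
   ('f, 'p, 'v, 's, 'm) fm \<Rightarrow> ('v \<Rightarrow> 'm) \<Rightarrow> real" where
  "fval L M (Dist s t u) = (\<lambda>a. mdist M s (tval M a t) (tval M a u))"
| "fval L M (Pred P ts) = (\<lambda>a. pint M P (map (tval M a) ts))"
| "fval L M (Conn u \<phi>s) = (\<lambda>a. u (map (\<lambda>g. g a) (map (fval L M) \<phi>s)))"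
| "fval L M (SupQ v \<phi>) = (\<lambda>a. SUP m\<in>univ M (vsort L v). fval L M \<phi> (a(v := m)))"
| "fval L M (InfQ v \<phi>) = (\<lambda>a. INF m\<in>univ M (vsort L v). fval L M \<phi> (a(v := m)))"

definition assignments ::
  "('f, 'p, 'v, 's) language \<Rightarrow> ('f, 'p, 's, 'm) mstruct \<Rightarrow> ('v \<Rightarrow> 'm) set" where
  "assignments L M = {a. \<forall>v. a v \<in> univ M (vsort L v)}"

text \<open>A theory is a set of sentences without parameters; \<open>\<sigma> \<in> T\<close> stands for the condition \<open>\<sigma> = 0\<close>.\<close>

definition sentences :: "('f, 'p, 'v, 's) language \<Rightarrow> ('f, 'p, 'v, 's, 'm) fm set" where
  "sentences L = {\<sigma>. wf_fm L (\<lambda>_. {}) \<sigma> \<and> fv \<sigma> = {}}"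

definition theory_of ::
  "('f, 'p, 'v, 's) language \<Rightarrow> ('f, 'p, 's, 'm) mstruct \<Rightarrow> ('f, 'p, 'v, 's, 'm) fm set" where
  "theory_of L M = {\<sigma> \<in> sentences L. \<forall>a\<in>assignments L M. fval L M \<sigma> a = 0}"

definition models ::
  "('f, 'p, 'v, 's) language \<Rightarrow> ('f, 'p, 's, 'm) mstruct \<Rightarrow> ('f, 'p, 'v, 's, 'm) fm set \<Rightarrow> bool" where
  "models L M T \<longleftrightarrow> T \<subseteq> theory_of L M"

text \<open>
  Complete theories are those of the form \<open>Th(N)\<close>. If also \<open>M \<Turnstile> T\<close>, then \<open>T = Th(M)\<close>, so it does
  not matter that \<open>N\<close> is taken here over the same HOL type as \<open>M\<close>.
\<close>

definition complete_theory ::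
  "('f, 'p, 'v, 's) language \<Rightarrow> ('f, 'p, 'v, 's, 'm) fm set \<Rightarrow> bool" where
  "complete_theory L T \<longleftrightarrow>
     (\<exists>N :: ('f, 'p, 's, 'm) mstruct. metric_structure L N \<and> T = theory_of L N)"


section \<open>Types over \<open>M\<close> and definable predicates\<close>

text \<open>A tuple of distinct variables is represented by the (possibly infinite) set of its entries.\<close>

definition formulas ::
  "('f, 'p, 'v, 's) language \<Rightarrow> ('f, 'p, 's, 'm) mstruct \<Rightarrow> 'v set \<Rightarrow>
   ('f, 'p, 'v, 's, 'm) fm set" where
  "formulas L M x = {\<phi>. wf_fm L (univ M) \<phi> \<and> fv \<phi> \<subseteq> x}"

text \<open>
  A complete type \<open>p\<close> over \<open>M\<close> in \<open>x\<close> is recorded by the values \<open>p \<phi>\<close> it assigns to the formulas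
  \<open>\<phi>(x)\<close> over \<open>M\<close>, i.e. it is the set of conditions \<open>\<phi>(x) = p \<phi>\<close>. Such a set is consistent with the
  elementary diagram of \<open>M\<close> iff it is finitely approximately satisfiable in \<open>M\<close>.
\<close>

definition complete_types ::
  "('f, 'p, 'v, 's) language \<Rightarrow> ('f, 'p, 's, 'm) mstruct \<Rightarrow> 'v set \<Rightarrow>
   (('f, 'p, 'v, 's, 'm) fm \<Rightarrow> real) set" where
  "complete_types L M x =
     {p \<in> extensional (formulas L M x).
        \<forall>F e. finite F \<and> F \<subseteq> formulas L M x \<and> 0 < e \<longrightarrow>
          (\<exists>a\<in>assignments L M. \<forall>\<phi>\<in>F. \<bar>fval L M \<phi> a - p \<phi>\<bar> < e)}"

text \<open>The logic topology: the coarsest one for which all evaluations \<open>p \<mapsto> p \<phi>\<close> are continuous.\<close>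

definition type_space ::
  "('f, 'p, 'v, 's) language \<Rightarrow> ('f, 'p, 's, 'm) mstruct \<Rightarrow> 'v set \<Rightarrow>
   (('f, 'p, 'v, 's, 'm) fm \<Rightarrow> real) topology" where
  "type_space L M x =
     subtopology (product_topology (\<lambda>_. euclideanreal) (formulas L M x)) (complete_types L M x)"

definition definable_predicate ::
  "('f, 'p, 'v, 's) language \<Rightarrow> ('f, 'p, 's, 'm) mstruct \<Rightarrow> 'v set \<Rightarrow>
   ((('f, 'p, 'v, 's, 'm) fm \<Rightarrow> real) \<Rightarrow> real) \<Rightarrow> bool" where
  "definable_predicate L M x \<psi> \<longleftrightarrow> continuous_map (type_space L M x) euclideanreal \<psi>"

text \<open>For \<open>y \<subseteq> x\<close>: the type of a realization of \<open>p\<close>, with only the coordinates in \<open>y\<close> kept.\<close>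

definition restrict_type ::
  "('f, 'p, 'v, 's) language \<Rightarrow> ('f, 'p, 's, 'm) mstruct \<Rightarrow> 'v set \<Rightarrow>
   (('f, 'p, 'v, 's, 'm) fm \<Rightarrow> real) \<Rightarrow> (('f, 'p, 'v, 's, 'm) fm \<Rightarrow> real)" where
  "restrict_type L M y p = restrict p (formulas L M y)"


section \<open>Keisler measures and weak orthogonality\<close>

definition regular_Borel_probability :: "'a topology \<Rightarrow> 'a measure \<Rightarrow> bool" where
  "regular_Borel_probability S \<mu> \<longleftrightarrow>
     space \<mu> = topspace S \<and> sets \<mu> = sigma_sets (topspace S) {U. openin S U} \<and>
     prob_space \<mu> \<and>
     (\<forall>A\<in>sets \<mu>.
        emeasure \<mu> A = (INF U\<in>{U. openin S U \<and> A \<subseteq> U}. emeasure \<mu> U) \<and>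
        emeasure \<mu> A = (SUP K\<in>{K. compactin S K \<and> closedin S K \<and> K \<subseteq> A}. emeasure \<mu> K))"

definition keisler_measures ::
  "('f, 'p, 'v, 's) language \<Rightarrow> ('f, 'p, 's, 'm) mstruct \<Rightarrow> 'v set \<Rightarrow>
   (('f, 'p, 'v, 's, 'm) fm \<Rightarrow> real) measure set" where
  "keisler_measures L M x = {\<mu>. regular_Borel_probability (type_space L M x) \<mu>}"

text \<open>In the following, the tuples \<open>x 1, \<dots>, x n\<close> are meant to be pairwise disjoint.\<close>

definition product_measure ::
  "('f, 'p, 'v, 's) language \<Rightarrow> ('f, 'p, 's, 'm) mstruct \<Rightarrow> nat \<Rightarrow> (nat \<Rightarrow> 'v set) \<Rightarrow>
   (nat \<Rightarrow> (('f, 'p, 'v, 's, 'm) fm \<Rightarrow> real) measure) \<Rightarrow>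
   (('f, 'p, 'v, 's, 'm) fm \<Rightarrow> real) measure \<Rightarrow> bool" where
  "product_measure L M n x \<mu> \<omega> \<longleftrightarrow>
     \<omega> \<in> keisler_measures L M (\<Union>i\<in>{1..n}. x i) \<and>
     (\<forall>\<psi>. (\<forall>i\<in>{1..n}. definable_predicate L M (x i) (\<psi> i)) \<longrightarrow>
        (\<integral>p. (\<Prod>i\<in>{1..n}. \<psi> i (restrict_type L M (x i) p)) \<partial>\<omega>) =
        (\<Prod>i\<in>{1..n}. \<integral>q. \<psi> i q \<partial>\<mu> i))"

definition weakly_orthogonal ::
  "('f, 'p, 'v, 's) language \<Rightarrow> ('f, 'p, 's, 'm) mstruct \<Rightarrow> nat \<Rightarrow> (nat \<Rightarrow> 'v set) \<Rightarrow>
   (nat \<Rightarrow> (('f, 'p, 'v, 's, 'm) fm \<Rightarrow> real) measure) \<Rightarrow> bool" where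
  "weakly_orthogonal L M n x \<mu> \<longleftrightarrow> (\<exists>!\<omega>. product_measure L M n x \<mu> \<omega>)"

definition sum_of_products ::
  "('f, 'p, 'v, 's) language \<Rightarrow> ('f, 'p, 's, 'm) mstruct \<Rightarrow> nat \<Rightarrow> (nat \<Rightarrow> 'v set) \<Rightarrow>
   ((('f, 'p, 'v, 's, 'm) fm \<Rightarrow> real) \<Rightarrow> real) \<Rightarrow> bool" where
  "sum_of_products L M n x \<psi> \<longleftrightarrow>
     (\<exists>(m::nat) \<theta>.
        (\<forall>i\<in>{1..n}. \<forall>j\<in>{1..m}. definable_predicate L M (x i) (\<theta> i j)) \<and>
        (\<forall>p\<in>complete_types L M (\<Union>i\<in>{1..n}. x i).
           \<psi> p = (\<Sum>j\<in>{1..m}. \<Prod>i\<in>{1..n}. \<theta> i j (restrict_type L M (x i) p))))"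

end

theory Submission
  imports Defs
begin

text \<open>
  The product functional \<open>\<Sum>\<^sub>j \<Prod>\<^sub>i \<theta>\<^sub>i\<^sub>j \<mapsto> \<Sum>\<^sub>j \<Prod>\<^sub>i \<integral>\<theta>\<^sub>i\<^sub>j d\<mu>\<^sub>i\<close> is well defined and positive on sums of products:
  types in disjoint tuples have a common extension, so a nonnegative sum of products is
  nonnegative at every tuple of types, and the variables can be integrated out one at a time.
  Let \<open>p(\<phi>)\<close> be the infimum of the values of the sums of products above \<open>\<phi>\<close>. This is sublinear, so
  by Hahn-Banach and Riesz some product measure integrates \<open>\<phi>\<close> to \<open>p(\<phi>)\<close>, and likewise some
  product measure integrates \<open>\<phi>\<close> to \<open>-p(-\<phi>)\<close>. If the product measure is unique, the two values
  agree, which yields \<open>\<psi>\<^sup>-\<close> and \<open>\<psi>\<^sup>+\<close>. Conversely, \<open>\<psi>\<^sup>-\<close> and \<open>\<psi>\<^sup>+\<close> have the same integral for all product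
  measures, so the sandwich forces any two of them to agree on every \<open>\<phi>\<close>.
\<close>

section \<open>The Hahn-Banach theorem for function spaces\<close>

text \<open>No joint measure is available at the start: only the integrals of sums of products are
  prescribed, and the type spaces enter to show that this prescription is positive. What remains is
  a moment problem on a compact Hausdorff space, stated without logic.

  Domination by \<open>p\<close> is all that the extension has to satisfy. Tested on a sum of
  products and on its negative it yields the prescribed value, and tested on nonpositive functions
  it yields positivity. The numbers \<open>- p (- \<phi>)\<close> and \<open>p \<phi>\<close> are
  thus the endpoints of the range of possible integrals of \<open>\<phi>\<close>, and it matters
  that both are attained; hence a form of Hahn-Banach with a prescribed value at one vector.

  Type spaces need not be metrizable, so regularity of a Borel measure is not automatic. It is what
  makes the integrals of continuous functions determine the measure, and the Riesz construction has
  to deliver it.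

  Existence of a product measure is used twice: it is part of weak orthogonality, and it keeps the
  quantifier over product measures in (2) from being vacuous.\<close>

lemma le_INF_add_INF:
  fixes F :: "'a \<Rightarrow> real" and G :: "'b \<Rightarrow> real"
  assumes "A \<noteq> {}" "B \<noteq> {}" "\<And>s t. s \<in> A \<Longrightarrow> t \<in> B \<Longrightarrow> z \<le> F s + G t"
  shows "z \<le> (INF s\<in>A. F s) + (INF t\<in>B. G t)"
proof -
  have "z - G t \<le> (INF s\<in>A. F s)" if "t \<in> B" for t
    using assms that by (intro cINF_greatest) (auto simp: algebra_simps)
  then have "z - (INF s\<in>A. F s) \<le> (INF t\<in>B. G t)"
    using assms by (intro cINF_greatest) (auto simp: algebra_simps)
  then show ?thesis by simp
qed

definition function_space :: "('a \<Rightarrow> real) set \<Rightarrow> bool" where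
  "function_space V \<longleftrightarrow> (\<lambda>_. 0) \<in> V \<and> (\<forall>f\<in>V. \<forall>g\<in>V. (\<lambda>x. f x + g x) \<in> V) \<and>
     (\<forall>f\<in>V. \<forall>c. (\<lambda>x. c * f x) \<in> V)"

text \<open>Values off \<open>V\<close> are left free. Admitting \<open>c = 0\<close> makes
  \<open>q\<close> vanish at the zero function.\<close>

definition sublinear_on :: "('a \<Rightarrow> real) set \<Rightarrow> (('a \<Rightarrow> real) \<Rightarrow> real) \<Rightarrow> bool" where
  "sublinear_on V q \<longleftrightarrow> (\<forall>f\<in>V. \<forall>g\<in>V. q (\<lambda>x. f x + g x) \<le> q f + q g) \<and>
     (\<forall>f\<in>V. \<forall>c\<ge>0. q (\<lambda>x. c * f x) = c * q f)"

lemma sublinear_on_add: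
  "sublinear_on V q \<Longrightarrow> f \<in> V \<Longrightarrow> g \<in> V \<Longrightarrow> q (\<lambda>x. f x + g x) \<le> q f + q g"
  and sublinear_on_scale:
  "sublinear_on V q \<Longrightarrow> f \<in> V \<Longrightarrow> 0 \<le> c \<Longrightarrow> q (\<lambda>x. c * f x) = c * q f"
  by (auto simp: sublinear_on_def)

section \<open>Minimal sublinear functionals\<close>

context
  fixes V :: "('a \<Rightarrow> real) set"
  assumes V: "function_space V"
begin

lemma fs_add [intro]: "f \<in> V \<Longrightarrow> g \<in> V \<Longrightarrow> (\<lambda>x. f x + g x) \<in> V"
  and fs_scale [intro]: "f \<in> V \<Longrightarrow> (\<lambda>x. c * f x) \<in> V"
  and fs_zero [intro]: "(\<lambda>_. 0) \<in> V"
  using V by (auto simp: function_space_def)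

lemma fs_minus [intro]: "f \<in> V \<Longrightarrow> (\<lambda>x. - f x) \<in> V"
  using fs_scale[of f "-1"] by simp

lemma sublinear_on_zero: "sublinear_on V q \<Longrightarrow> q (\<lambda>_. 0) = 0"
  using sublinear_on_scale[of V q "\<lambda>_. 0" 0] fs_zero by simp

lemma sublinear_on_ge_minus: "sublinear_on V q \<Longrightarrow> f \<in> V \<Longrightarrow> - q (\<lambda>x. - f x) \<le> q f"
  using sublinear_on_add[of V q f "\<lambda>x. - f x"] fs_minus[of f] sublinear_on_zero[of q] by simp

text \<open>The functional is the infimum over \<open>t \<ge> 0\<close> of q(f + t v) - t q(v). The
  choices \<open>t = 0\<close> and \<open>t = 1\<close> give the two bounds. At f = -v the second
  bound reads r(-v) \<le> -q(v), which forces every linear functional below \<open>r\<close> to take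
  the value \<open>q v\<close> at \<open>v\<close>.\<close>

lemma sublinear_on_shift:
  assumes q: "sublinear_on V q" and v: "v \<in> V"
  obtains r where "sublinear_on V r" "\<And>f. f \<in> V \<Longrightarrow> r f \<le> q f"
    "\<And>f. f \<in> V \<Longrightarrow> r f \<le> q (\<lambda>x. f x + v x) - q v"
proof -
  define F where "F f t = q (\<lambda>x. f x + t * v x) - t * q v" for f t
  define r where "r f = (INF t\<in>{0..}. F f t)" for f
  \<comment> \<open>Subadditivity is applied to t v = (f + t v) + (-f). The resulting bound does not
    involve \<open>t\<close>, so the infimum is finite.\<close>
  have lower: "- q (\<lambda>x. - f x) \<le> F f t" if "f \<in> V" "0 \<le> t" for f t
    using sublinear_on_add[OF q fs_add[OF that(1) fs_scale[OF v, of t]] fs_minus[OF that(1)]]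
      sublinear_on_scale[OF q v that(2)]
    by (simp add: F_def)
  have le: "r f \<le> F f t" if "f \<in> V" "0 \<le> t" for f t
    unfolding r_def using lower that by (intro cINF_lower bdd_belowI2[of _ "- q (\<lambda>x. - f x)"]) auto
  have add: "r (\<lambda>x. f x + g x) \<le> r f + r g" if "f \<in> V" "g \<in> V" for f g
    unfolding r_def[of f] r_def[of g]
  proof (rule le_INF_add_INF)
    fix s t :: real assume "s \<in> {0..}" "t \<in> {0..}"
    \<comment> \<open>Parameters \<open>s\<close> for \<open>f\<close> and \<open>t\<close> for
      \<open>g\<close> combine to the parameter \<open>s + t\<close> for the sum.\<close>
    then have "r (\<lambda>x. f x + g x) \<le> F (\<lambda>x. f x + g x) (s + t)"
      using that by (intro le) auto
    also have "\<dots> \<le> F f s + F g t"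
      using sublinear_on_add[OF q fs_add[OF that(1) fs_scale[OF v, of s]] fs_add[OF that(2) fs_scale[OF v, of t]]]
      by (simp add: F_def algebra_simps)
    finally show "r (\<lambda>x. f x + g x) \<le> F f s + F g t" .
  qed auto
  have scale_le: "c * r f \<le> r (\<lambda>x. c * f x)" if "f \<in> V" "0 < c" for c f
    unfolding r_def[of "\<lambda>x. c * f x"]
  proof (rule cINF_greatest)
    fix t :: real assume t: "t \<in> {0..}"
    have "q (\<lambda>x. c * (f x + t / c * v x)) = c * q (\<lambda>x. f x + t / c * v x)"
      using that by (intro sublinear_on_scale[OF q fs_add[OF _ fs_scale[OF v]]]) auto
    then have "F (\<lambda>x. c * f x) t = c * F f (t / c)"
      using that by (simp add: F_def algebra_simps)
    moreover have "r f \<le> F f (t / c)"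
      using that t by (intro le) auto
    ultimately show "c * r f \<le> F (\<lambda>x. c * f x) t"
      using that by simp
  qed auto
  have scale: "r (\<lambda>x. c * f x) = c * r f" if "f \<in> V" "0 < c" for c f
    using scale_le[OF that] scale_le[of "\<lambda>x. c * f x" "1 / c"] that fs_scale[of f c]
    by (simp add: field_simps)
  have "F (\<lambda>_. 0) t = 0" if "0 \<le> t" for t
    using sublinear_on_scale[OF q v that] by (simp add: F_def)
  then have "r (\<lambda>_. 0) = 0" by (simp add: r_def)
  with scale have scale0: "r (\<lambda>x. c * f x) = c * r f" if "f \<in> V" "0 \<le> c" for c f
    using that by (cases "c = 0") auto
  show thesis
  proof (rule that)
    show "sublinear_on V r" using add scale0 by (auto simp: sublinear_on_def)
    show "r f \<le> q f" if "f \<in> V" for f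
      using le[OF that, of 0] by (simp add: F_def)
    show "r f \<le> q (\<lambda>x. f x + v x) - q v" if "f \<in> V" for f
      using le[OF that, of 1] by (simp add: F_def)
  qed
qed

text \<open>Zorn's lemma; a nonempty chain is bounded by its pointwise infimum. Subadditivity of
  that infimum uses that any two members of a chain have a common lower one.\<close>

lemma minimal_sublinear_exists:
  assumes p: "sublinear_on V p"
  obtains q where "sublinear_on V q" "\<And>f. f \<in> V \<Longrightarrow> q f \<le> p f"
    "\<And>r f. sublinear_on V r \<Longrightarrow> (\<And>g. g \<in> V \<Longrightarrow> r g \<le> q g) \<Longrightarrow> f \<in> V \<Longrightarrow> r f = q f"
proof -
  \<comment> \<open>Values off \<open>V\<close> are fixed to be 0: they are not constrained by
    sublinearity, and if they could be lowered forever, nothing would be minimal.\<close>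
  define Q where "Q = {q. sublinear_on V q \<and> (\<forall>f\<in>V. q f \<le> p f) \<and> (\<forall>f. f \<notin> V \<longrightarrow> q f = 0)}"
  \<comment> \<open>The order is reversed, so that the maximal element supplied by Zorn's lemma is a
    minimal functional.\<close>
  define P where "P q r \<longleftrightarrow> r \<le> q" for q r :: "('a \<Rightarrow> real) \<Rightarrow> real"
  have cut: "sublinear_on V (\<lambda>f. if f \<in> V then q f else 0)" if "sublinear_on V q" for q
    using that V unfolding sublinear_on_def function_space_def by auto
  have "\<exists>m\<in>Q. \<forall>a\<in>Q. P m a \<longrightarrow> a = m"
  proof (rule predicate_Zorn)
    show "partial_order_on Q (relation_of P Q)"
      by (auto simp: partial_order_on_def preorder_on_def refl_on_def trans_def antisym_def
          relation_of_def P_def)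
    fix C assume C: "C \<in> Chains (relation_of P Q)"
    then have CQ: "C \<subseteq> Q" and tot: "\<And>a b. a \<in> C \<Longrightarrow> b \<in> C \<Longrightarrow> a \<le> b \<or> b \<le> a"
      by (auto simp: Chains_def relation_of_def P_def)
    show "\<exists>u\<in>Q. \<forall>a\<in>C. P a u"
    proof (cases "C = {}")
      case True
      then show ?thesis using cut[OF p] by (auto simp: Q_def intro!: exI[of _ "\<lambda>f. if f \<in> V then p f else 0"])
    next
      case False
      define u where "u f = (INF q\<in>C. q f)" for f
      \<comment> \<open>From q(f) \<ge> -q(-f) and \<open>q \<le> p\<close> on \<open>V\<close>; the
        bound is common to the whole chain.\<close>
      have lower: "- p (\<lambda>x. - f x) \<le> q f" if "q \<in> C" "f \<in> V" for q f
      proof -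
        have "sublinear_on V q" "q (\<lambda>x. - f x) \<le> p (\<lambda>x. - f x)"
          using that CQ fs_minus[of f] by (auto simp: Q_def)
        then show ?thesis using sublinear_on_ge_minus[of q f] that by simp
      qed
      have le: "u f \<le> q f" if "q \<in> C" "f \<in> V" for q f
        unfolding u_def using that lower by (intro cINF_lower bdd_belowI2[of _ "- p (\<lambda>x. - f x)"]) auto
      have off: "u f = 0" if "f \<notin> V" for f
      proof -
        have "(\<lambda>q. q f) ` C = {0}"
        proof -
          have "q f = 0" if "q \<in> C" for q
          proof -
            have "q \<in> Q" using that CQ by blast
            then show ?thesis using \<open>f \<notin> V\<close> unfolding Q_def by blast
          qed
          then have "(\<lambda>q. q f) ` C = (\<lambda>q. 0) ` C" by (rule image_cong[OF refl])
          then show ?thesis using False by (auto simp: image_constant_conv)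
        qed
        then show ?thesis by (simp add: u_def)
      qed
      have add: "u (\<lambda>x. f x + g x) \<le> u f + u g" if "f \<in> V" "g \<in> V" for f g
        unfolding u_def[of f] u_def[of g]
      proof (rule le_INF_add_INF[OF False False])
        fix a b assume ab: "a \<in> C" "b \<in> C"
        obtain c where c: "c \<in> C" "c \<le> a" "c \<le> b" using tot[OF ab] ab by auto
        have "u (\<lambda>x. f x + g x) \<le> c (\<lambda>x. f x + g x)" using c that by (intro le) auto
        also have "\<dots> \<le> c f + c g" using c(1) CQ that by (intro sublinear_on_add) (auto simp: Q_def)
        also have "\<dots> \<le> a f + b g" using c by (intro add_mono) (auto simp: le_fun_def)
        finally show "u (\<lambda>x. f x + g x) \<le> a f + b g" .
      qed
      have scale: "u (\<lambda>x. c * f x) = c * u f" if "f \<in> V" "0 \<le> c" for c f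
      proof (rule antisym)
        have "u (\<lambda>x. c * f x) \<le> c * q f" if "q \<in> C" for q
        proof -
          have "sublinear_on V q" using that CQ by (auto simp: Q_def)
          then have "q (\<lambda>x. c * f x) = c * q f"
            using \<open>f \<in> V\<close> \<open>0 \<le> c\<close> by (rule sublinear_on_scale)
          then show ?thesis using le[OF that fs_scale[OF \<open>f \<in> V\<close>, of c]] by (rule subst)
        qed
        then show "u (\<lambda>x. c * f x) \<le> c * u f"
        proof (cases "c = 0")
          case True
          obtain q where "q \<in> C" using False by auto
          then show ?thesis using \<open>\<And>q. q \<in> C \<Longrightarrow> u (\<lambda>x. c * f x) \<le> c * q f\<close>[of q] True by simp
        next
          case c: False
          then have "u (\<lambda>x. c * f x) / c \<le> u f"
            unfolding u_def[of f] using False \<open>0 \<le> c\<close> \<open>\<And>q. q \<in> C \<Longrightarrow> u (\<lambda>x. c * f x) \<le> c * q f\<close>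
            by (intro cINF_greatest) (auto simp: field_simps)
          then show ?thesis using c \<open>0 \<le> c\<close> by (simp add: field_simps)
        qed
        show "c * u f \<le> u (\<lambda>x. c * f x)"
          unfolding u_def[of "\<lambda>x. c * f x"]
        proof (rule cINF_greatest[OF False])
          fix q assume q: "q \<in> C"
          then have "q (\<lambda>x. c * f x) = c * q f"
            using CQ that by (intro sublinear_on_scale) (auto simp: Q_def)
          then show "c * u f \<le> q (\<lambda>x. c * f x)" using le[OF q that(1)] that(2) by (simp add: mult_left_mono)
        qed
      qed
      have "u f \<le> p f" if "f \<in> V" for f
      proof -
        obtain q where "q \<in> C" using False by auto
        then show ?thesis using le[of q f] CQ that by (fastforce simp: Q_def)
      qed
      then have "u \<in> Q" using add scale off by (auto simp: Q_def sublinear_on_def)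
      moreover have "u f \<le> a f" if "a \<in> C" for a f
        using le[OF that, of f] off[of f] CQ that by (cases "f \<in> V") (auto simp: Q_def)
      ultimately show ?thesis by (auto simp: P_def le_fun_def)
    qed
  qed
  then obtain q where q: "q \<in> Q" "\<And>a. a \<in> Q \<Longrightarrow> a \<le> q \<Longrightarrow> a = q"
    by (auto simp: P_def)
  show thesis
  proof (rule that)
    show "sublinear_on V q" "\<And>f. f \<in> V \<Longrightarrow> q f \<le> p f" using q by (auto simp: Q_def)
    fix r f assume r: "sublinear_on V r" "\<And>g. g \<in> V \<Longrightarrow> r g \<le> q g" and f: "f \<in> V"
    let ?r = "\<lambda>f. if f \<in> V then r f else 0"
    have "?r \<in> Q" "?r \<le> q"
      using cut[OF r(1)] r(2) q(1) by (auto simp: Q_def le_fun_def intro: order_trans)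
    then have "?r = q" by (rule q(2))
    from fun_cong[OF this, of f] f show "r f = q f" by simp
  qed
qed

text \<open>
  A minimal sublinear functional is linear, since its shifts along any vector lie below it.
\<close>

theorem hahn_banach_attaining:
  assumes p: "sublinear_on V p" and v: "v \<in> V"
  obtains \<Lambda> where "\<And>f g. f \<in> V \<Longrightarrow> g \<in> V \<Longrightarrow> \<Lambda> (\<lambda>x. f x + g x) = \<Lambda> f + \<Lambda> g"
    "\<And>c f. f \<in> V \<Longrightarrow> \<Lambda> (\<lambda>x. c * f x) = c * \<Lambda> f"
    "\<And>f. f \<in> V \<Longrightarrow> \<Lambda> f \<le> p f" "\<Lambda> v = p v"
proof -
  obtain r where r: "sublinear_on V r" "\<And>f. f \<in> V \<Longrightarrow> r f \<le> p f"
    "\<And>f. f \<in> V \<Longrightarrow> r f \<le> p (\<lambda>x. f x + v x) - p v"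
    using sublinear_on_shift[OF p v] by blast
  obtain q where q: "sublinear_on V q" "\<And>f. f \<in> V \<Longrightarrow> q f \<le> r f"
    and q_min: "\<And>r f. sublinear_on V r \<Longrightarrow> (\<And>g. g \<in> V \<Longrightarrow> r g \<le> q g) \<Longrightarrow> f \<in> V \<Longrightarrow> r f = q f"
    using minimal_sublinear_exists[OF r(1)] by blast
  have add: "q (\<lambda>x. f x + g x) = q f + q g" if fg: "f \<in> V" "g \<in> V" for f g
  proof (rule antisym)
    show "q (\<lambda>x. f x + g x) \<le> q f + q g" using q(1) that by (rule sublinear_on_add)
    obtain s where s: "sublinear_on V s" "\<And>f. f \<in> V \<Longrightarrow> s f \<le> q f"
      "\<And>f. f \<in> V \<Longrightarrow> s f \<le> q (\<lambda>x. f x + g x) - q g"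
      using sublinear_on_shift[OF q(1) fg(2)] by blast
    have "s f = q f" using s(1,2) fg(1) by (rule q_min)
    then show "q f + q g \<le> q (\<lambda>x. f x + g x)" using s(3)[OF fg(1)] by linarith
  qed
  have minus: "q (\<lambda>x. - f x) = - q f" if "f \<in> V" for f
    using add[OF that fs_minus[OF that]] sublinear_on_zero[OF q(1)] by simp
  have scale: "q (\<lambda>x. c * f x) = c * q f" if "f \<in> V" for c f
  proof (cases "0 \<le> c")
    case True
    then show ?thesis using q(1) that by (simp add: sublinear_on_scale)
  next
    case False
    then show ?thesis
      using sublinear_on_scale[OF q(1) fs_minus[OF that], of "- c"] minus[OF that] by simp
  qed
  have "q v = p v"
  proof (rule antisym)
    show "q v \<le> p v" using q(2) r(2) v by (meson order_trans)
    \<comment> \<open>The second bound on the shift, evaluated at -v, where f + v is the zero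
      function.\<close>
    have "q (\<lambda>x. - v x) \<le> - p v"
      using q(2)[OF fs_minus[OF v]] r(3)[OF fs_minus[OF v]] sublinear_on_zero[OF p] by simp
    then show "p v \<le> q v" using minus[OF v] by simp
  qed
  moreover have "q f \<le> p f" if "f \<in> V" for f
    using q(2)[OF that] r(2)[OF that] by simp
  ultimately show thesis using add scale by (intro that)
qed

end

section \<open>Riesz representation on compact Hausdorff spaces\<close>

abbreviation cont_real :: "'a topology \<Rightarrow> ('a \<Rightarrow> real) \<Rightarrow> bool" where
  "cont_real S \<equiv> continuous_map S euclideanreal"

lemma cont_real_bounded:
  assumes "compact_space S" "cont_real S f"
  obtains B where "0 < B" "\<And>x. x \<in> topspace S \<Longrightarrow> \<bar>f x\<bar> \<le> B"
proof -
  have "compactin euclideanreal (f ` topspace S)"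
    using assms by (metis image_compactin compact_space_def)
  then have "bounded (f ` topspace S)" by (simp add: compact_imp_bounded)
  then show thesis by (auto simp: bounded_pos that)
qed

lemma regular_Borel_probability_sets:
  "regular_Borel_probability S \<omega> \<Longrightarrow> openin S U \<Longrightarrow> U \<in> sets \<omega>"
  "regular_Borel_probability S \<omega> \<Longrightarrow> closedin S K \<Longrightarrow> K \<in> sets \<omega>"
proof -
  assume R: "regular_Borel_probability S \<omega>"
  show U: "U \<in> sets \<omega>" if "openin S U" for U
    using R that by (auto simp: regular_Borel_probability_def)
  assume K: "closedin S K"
  then have "space \<omega> - (topspace S - K) \<in> sets \<omega>"
    by (intro sets.compl_sets U) (simp add: openin_diff)
  moreover have "topspace S - (topspace S - K) = K" using closedin_subset[OF K] by auto
  ultimately show "K \<in> sets \<omega>" using R by (simp add: regular_Borel_probability_def)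
qed

lemma regular_Borel_probability_integrable:
  assumes "compact_space S" "regular_Borel_probability S \<omega>" "cont_real S f"
  shows "integrable \<omega> f"
proof -
  interpret prob_space \<omega> using assms by (simp add: regular_Borel_probability_def)
  have sp: "space \<omega> = topspace S" using assms by (simp add: regular_Borel_probability_def)
  obtain B where "\<And>x. x \<in> topspace S \<Longrightarrow> \<bar>f x\<bar> \<le> B"
    using cont_real_bounded[OF assms(1,3)] by blast
  moreover have "f \<in> borel_measurable \<omega>"
  proof (rule borel_measurableI)
    fix U :: "real set" assume "open U"
    then have "openin S {x \<in> topspace S. f x \<in> U}"
      using assms(3) by (intro openin_continuous_map_preimage) auto
    moreover have "f -` U \<inter> space \<omega> = {x \<in> topspace S. f x \<in> U}" using sp by auto
    ultimately show "f -` U \<inter> space \<omega> \<in> sets \<omega>"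
      using regular_Borel_probability_sets[OF assms(2)] by simp
  qed
  ultimately show ?thesis by (intro integrable_const_bound[of _ B]) (auto simp: sp)
qed

text \<open>
  Only \<open>{f \<noteq> 0} \<subseteq> U\<close> is required instead of the usual \<open>supp f \<subseteq> U\<close>; replacing \<open>f\<close> by
  \<open>max (f - e) 0\<close> recovers a closed support at a cost of at most \<open>e\<close> in a normalized functional.
\<close>

definition below :: "'a topology \<Rightarrow> 'a set \<Rightarrow> ('a \<Rightarrow> real) set" where
  "below S U = {f. cont_real S f \<and> (\<forall>x\<in>topspace S. 0 \<le> f x \<and> f x \<le> 1) \<and>
     (\<forall>x\<in>topspace S - U. f x = 0)}"

lemma zero_in_below: "(\<lambda>_. 0) \<in> below S U"
  by (simp add: below_def)

lemma below_mono: "U \<subseteq> V \<Longrightarrow> below S U \<subseteq> below S V"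
  by (auto simp: below_def)

lemma below_bump:
  assumes "compact_space S" "Hausdorff_space S" "closedin S K" "openin S U" "K \<subseteq> U"
  obtains h where "h \<in> below S U" "\<And>x. x \<in> K \<Longrightarrow> h x = 1"
proof -
  have "normal_space S" using assms by (simp add: compact_Hausdorff_or_regular_imp_normal_space)
  moreover have "closedin S (topspace S - U)" using assms by (simp add: closedin_diff)
  moreover have "disjnt (topspace S - U) K" using assms by (auto simp: disjnt_def)
  ultimately obtain h where "continuous_map S (top_of_set {0..1::real}) h"
    "h ` (topspace S - U) \<subseteq> {0}" "h ` K \<subseteq> {1}"
    using assms(3) by (elim Urysohn_lemma[of S "topspace S - U" K 0 1]) auto
  then show thesis
    by (intro that[of h]) (auto simp: below_def continuous_map_in_subtopology)
qed

text \<open>For closed \<open>K\<close> inside open \<open>U\<close>, a Urysohn function between the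
  two indicators gives \<omega>(K) \<le> \<omega>'(U). Inner regularity of the first measure and
  outer regularity of the second extend this comparison to every Borel set, and the situation is
  symmetric.\<close>

theorem regular_Borel_probability_eqI:
  assumes S: "compact_space S" "Hausdorff_space S"
    and R: "regular_Borel_probability S \<omega>" "regular_Borel_probability S \<omega>'"
    and eq: "\<And>f. cont_real S f \<Longrightarrow> integral\<^sup>L \<omega> f = integral\<^sup>L \<omega>' f"
  shows "\<omega> = \<omega>'"
proof -
  have le: "emeasure \<omega> A \<le> emeasure \<omega>' A"
    if R: "regular_Borel_probability S \<omega>" "regular_Borel_probability S \<omega>'"
    and eq: "\<And>f. cont_real S f \<Longrightarrow> integral\<^sup>L \<omega> f = integral\<^sup>L \<omega>' f"
    and A: "A \<in> sets \<omega>" for \<omega> \<omega>' :: "'a measure" and A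
  proof -
    interpret P: prob_space \<omega> using R by (simp add: regular_Borel_probability_def)
    interpret P': prob_space \<omega>' using R by (simp add: regular_Borel_probability_def)
    have sp: "space \<omega> = topspace S" "space \<omega>' = topspace S" "sets \<omega>' = sets \<omega>"
      using R by (auto simp: regular_Borel_probability_def)
    have "emeasure \<omega> K \<le> emeasure \<omega>' U" if KU: "closedin S K" "openin S U" "K \<subseteq> U" for K U
    proof -
      obtain h where h: "h \<in> below S U" "\<And>x. x \<in> K \<Longrightarrow> h x = 1"
        using below_bump[OF S KU] by blast
      then have ch: "cont_real S h" by (simp add: below_def)
      note int = regular_Borel_probability_integrable[OF S(1) _ ch]
      have "measure \<omega> K = (\<integral>x. indicat_real K x \<partial>\<omega>)"
        using regular_Borel_probability_sets(2)[OF R(1) KU(1)] by simp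
      also have "\<dots> \<le> integral\<^sup>L \<omega> h"
        using h regular_Borel_probability_sets(2)[OF R(1) KU(1)]
        by (intro integral_mono int R integrable_real_indicator)
          (auto simp: sp below_def indicator_def P.emeasure_eq_measure)
      also have "\<dots> = integral\<^sup>L \<omega>' h" by (rule eq[OF ch])
      also have "\<dots> \<le> (\<integral>x. indicat_real U x \<partial>\<omega>')"
        using h regular_Borel_probability_sets(1)[OF R(2) KU(2)]
        by (intro integral_mono int R integrable_real_indicator)
          (auto simp: sp below_def indicator_def P'.emeasure_eq_measure)
      also have "\<dots> = measure \<omega>' U"
        using regular_Borel_probability_sets(1)[OF R(2) KU(2)] by simp
      finally show ?thesis
        by (simp add: P.emeasure_eq_measure P'.emeasure_eq_measure)
    qed
    then have "(SUP K\<in>{K. compactin S K \<and> closedin S K \<and> K \<subseteq> A}. emeasure \<omega> K) \<le>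
        (INF U\<in>{U. openin S U \<and> A \<subseteq> U}. emeasure \<omega>' U)"
      by (intro SUP_least INF_greatest) blast
    moreover have "emeasure \<omega> A = (SUP K\<in>{K. compactin S K \<and> closedin S K \<and> K \<subseteq> A}. emeasure \<omega> K)"
      using R(1) A unfolding regular_Borel_probability_def by blast
    moreover have "emeasure \<omega>' A = (INF U\<in>{U. openin S U \<and> A \<subseteq> U}. emeasure \<omega>' U)"
      using R(2) A unfolding sp(3)[symmetric] regular_Borel_probability_def by blast
    ultimately show ?thesis by simp
  qed
  show ?thesis
  proof (rule measure_eqI)
    show sets_eq: "sets \<omega> = sets \<omega>'" using R by (simp add: regular_Borel_probability_def)
    show "emeasure \<omega> A = emeasure \<omega>' A" if "A \<in> sets \<omega>" for A
    proof (rule antisym)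
      show "emeasure \<omega> A \<le> emeasure \<omega>' A"
        using R eq that by (rule le)
      show "emeasure \<omega>' A \<le> emeasure \<omega> A"
        using R(2,1) by (rule le) (use eq that sets_eq in auto)
    qed
  qed
qed

section \<open>Normalized positive functionals\<close>

locale normalized_positive_functional =
  fixes S :: "'a topology" and \<Lambda> :: "('a \<Rightarrow> real) \<Rightarrow> real"
  assumes compact: "compact_space S" and Hausdorff: "Hausdorff_space S"
    and add: "\<And>f g. cont_real S f \<Longrightarrow> cont_real S g \<Longrightarrow> \<Lambda> (\<lambda>x. f x + g x) = \<Lambda> f + \<Lambda> g"
    and scale: "\<And>c f. cont_real S f \<Longrightarrow> \<Lambda> (\<lambda>x. c * f x) = c * \<Lambda> f"
    and nonneg: "\<And>f. cont_real S f \<Longrightarrow> (\<And>x. x \<in> topspace S \<Longrightarrow> 0 \<le> f x) \<Longrightarrow> 0 \<le> \<Lambda> f"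
    and one: "\<Lambda> (\<lambda>_. 1) = 1"
begin

lemma diff: "cont_real S f \<Longrightarrow> cont_real S g \<Longrightarrow> \<Lambda> (\<lambda>x. f x - g x) = \<Lambda> f - \<Lambda> g"
  using add[of f "\<lambda>x. -1 * g x"] scale[of g "-1"] by (simp add: continuous_map_minus)

lemma mono:
  "cont_real S f \<Longrightarrow> cont_real S g \<Longrightarrow> (\<And>x. x \<in> topspace S \<Longrightarrow> f x \<le> g x) \<Longrightarrow> \<Lambda> f \<le> \<Lambda> g"
  using nonneg[of "\<lambda>x. g x - f x"] diff[of g f] by (simp add: continuous_map_diff)

text \<open>Functions live on the whole HOL type, whereas positivity is tested on
  \<open>topspace S\<close>; so \<Lambda> sees only the restriction of a continuous function to the
  space.\<close>

lemma cong:
  "cont_real S f \<Longrightarrow> cont_real S g \<Longrightarrow> (\<And>x. x \<in> topspace S \<Longrightarrow> f x = g x) \<Longrightarrow> \<Lambda> f = \<Lambda> g"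
  using mono[of f g] mono[of g f] by (simp add: order_antisym)

lemma const: "\<Lambda> (\<lambda>_. c) = c"
  using scale[of "\<lambda>_. 1" c] one by simp

lemma sum: "finite A \<Longrightarrow> (\<And>k. k \<in> A \<Longrightarrow> cont_real S (F k)) \<Longrightarrow> \<Lambda> (\<lambda>x. \<Sum>k\<in>A. F k x) = (\<Sum>k\<in>A. \<Lambda> (F k))"
  by (induction A rule: finite_induct) (simp_all add: const add continuous_map_sum)

lemma truncation:
  assumes f: "f \<in> below S U" and e: "0 < e"
  obtains K g where "closedin S K" "K \<subseteq> U" "g \<in> below S U" "\<And>x. x \<in> topspace S - K \<Longrightarrow> g x = 0"
    "\<Lambda> f \<le> \<Lambda> g + e"
proof (rule that)
  have cf: "cont_real S f" using f by (simp add: below_def)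
  show "closedin S {x \<in> topspace S. f x \<in> {e..}}"
    using cf by (intro closedin_continuous_map_preimage) auto
  show "{x \<in> topspace S. f x \<in> {e..}} \<subseteq> U" using f e by (force simp: below_def)
  have cg: "cont_real S (\<lambda>x. max (f x - e) 0)"
    using cf by (intro continuous_intros) auto
  then show "(\<lambda>x. max (f x - e) 0) \<in> below S U" using f e by (force simp: below_def)
  show "max (f x - e) 0 = 0" if "x \<in> topspace S - {x \<in> topspace S. f x \<in> {e..}}" for x
    using that by auto
  have "\<Lambda> f \<le> \<Lambda> (\<lambda>x. max (f x - e) 0 + e)"
    using cf cg by (intro mono continuous_intros) auto
  then show "\<Lambda> f \<le> \<Lambda> (\<lambda>x. max (f x - e) 0) + e"
    using add[OF cg, of "\<lambda>_. e"] const[of e] by simp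
qed

lemma below_nonneg: "f \<in> below S U \<Longrightarrow> 0 \<le> \<Lambda> f"
  by (auto simp: below_def intro: nonneg)

lemma below_le_1: "f \<in> below S U \<Longrightarrow> \<Lambda> f \<le> 1"
  using mono[of f "\<lambda>_. 1"] one by (simp add: below_def)

text \<open>The Riesz candidate for the measure of an open set; \<open>outer\<close> then builds
  outer regularity into its extension to all sets.\<close>

definition content :: "'a set \<Rightarrow> ennreal" where
  "content U = (SUP f\<in>below S U. ennreal (\<Lambda> f))"

definition outer :: "'a set \<Rightarrow> ennreal" where
  "outer A = (INF U\<in>{U. openin S U \<and> A \<subseteq> U}. content U)"

lemma content_upper: "f \<in> below S U \<Longrightarrow> ennreal (\<Lambda> f) \<le> content U"
  unfolding content_def by (rule SUP_upper)

lemma content_mono: "U \<subseteq> V \<Longrightarrow> content U \<le> content V"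
  unfolding content_def by (intro SUP_subset_mono below_mono) auto

lemma content_le_1: "content U \<le> 1"
  unfolding content_def using below_le_1 by (intro SUP_least) (simp add: ennreal_le_1)

lemma content_space: "content (topspace S) = 1"
proof (rule antisym[OF content_le_1])
  have "(\<lambda>_. 1) \<in> below S (topspace S)" by (simp add: below_def)
  from content_upper[OF this] show "1 \<le> content (topspace S)" by (simp add: one)
qed

lemma content_empty: "content {} = 0"
proof -
  have "\<Lambda> f = 0" if "f \<in> below S {}" for f
    using cong[of f "\<lambda>_. 0"] that const[of 0] by (simp add: below_def)
  then have "(SUP f\<in>below S {}. ennreal (\<Lambda> f)) = (SUP f\<in>below S {}. 0)" by (intro SUP_cong) auto
  then show ?thesis by (simp add: content_def SUP_constant bot_ennreal)
qed

text \<open>A two-piece partition of unity: after truncation \<open>g\<close> vanishes off a closed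
  \<open>K\<close>, and a Urysohn function \<open>h\<close> below \<open>U\<close> equals 1 on
  \<open>K - V\<close>. Then g h is below \<open>U\<close>, and g (1 - h) is below \<open>V\<close>
  because \<open>1 - h\<close> kills \<open>g\<close> on \<open>K - V\<close>.\<close>

lemma content_Un:
  assumes U: "openin S U" and V: "openin S V"
  shows "content (U \<union> V) \<le> content U + content V"
  unfolding content_def[of "U \<union> V"]
proof (rule SUP_least, rule ennreal_le_epsilon)
  fix f and e :: real assume f: "f \<in> below S (U \<union> V)" and e: "0 < e"
  obtain K g where K: "closedin S K" "K \<subseteq> U \<union> V" and g: "g \<in> below S (U \<union> V)"
    "\<And>x. x \<in> topspace S - K \<Longrightarrow> g x = 0" "\<Lambda> f \<le> \<Lambda> g + e"
    using truncation[OF f e] by blast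
  obtain h where h: "h \<in> below S U" "\<And>x. x \<in> K - V \<Longrightarrow> h x = 1"
    using below_bump[OF compact Hausdorff closedin_diff[OF K(1) V] U] K(2) by blast
  have cont: "cont_real S g" "cont_real S h" using g h by (auto simp: below_def)
  have c: "cont_real S (\<lambda>x. g x * h x)" "cont_real S (\<lambda>x. g x * (1 - h x))"
    using cont by (auto intro!: continuous_intros)
  have 1: "(\<lambda>x. g x * h x) \<in> below S U"
    using g(1) h(1) c by (auto simp: below_def mult_le_one)
  have 2: "(\<lambda>x. g x * (1 - h x)) \<in> below S V"
    using g(1,2) h c by (auto simp: below_def mult_le_one)
  have "\<Lambda> g = \<Lambda> (\<lambda>x. g x * h x + g x * (1 - h x))" by (simp add: algebra_simps)
  also have "\<dots> = \<Lambda> (\<lambda>x. g x * h x) + \<Lambda> (\<lambda>x. g x * (1 - h x))" by (rule add[OF c])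
  finally have "ennreal (\<Lambda> f) \<le> ennreal (\<Lambda> (\<lambda>x. g x * h x) + \<Lambda> (\<lambda>x. g x * (1 - h x)) + e)"
    using g(3) by (intro ennreal_leI) simp
  also have "\<dots> = ennreal (\<Lambda> (\<lambda>x. g x * h x)) + ennreal (\<Lambda> (\<lambda>x. g x * (1 - h x))) + ennreal e"
    using below_nonneg[OF 1] below_nonneg[OF 2] e by (simp add: ennreal_plus)
  also have "\<dots> \<le> content U + content V + ennreal e"
    by (intro add_mono content_upper 1 2 order_refl)
  finally show "ennreal (\<Lambda> f) \<le> content U + content V + ennreal e" .
qed

lemma content_UN_lessThan:
  "(\<And>i. openin S (U i)) \<Longrightarrow> content (\<Union>i<N. U i) \<le> (\<Sum>i<(N::nat). content (U i))"
proof (induction N)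
  case 0
  then show ?case by (simp add: content_empty)
next
  case (Suc N)
  have "content (\<Union>i<Suc N. U i) \<le> content (\<Union>i<N. U i) + content (U N)"
  proof -
    have "openin S (\<Union>i<N. U i)" using Suc.prems by (intro openin_Union) auto
    from content_Un[OF this Suc.prems[of N]] show ?thesis by (simp add: lessThan_Suc Un_commute)
  qed
  also have "\<dots> \<le> (\<Sum>i<N. content (U i)) + content (U N)"
    by (rule add_right_mono[OF Suc.IH[OF Suc.prems]])
  finally show ?case by simp
qed

text \<open>Truncation leaves a function that vanishes off a compact set. Finitely many of the open
  sets cover that set, so the finite case applies at the cost of \<open>e\<close>.\<close>

lemma content_UN:
  fixes U :: "nat \<Rightarrow> 'a set"
  assumes U: "\<And>i. openin S (U i)"
  shows "content (\<Union>i. U i) \<le> (\<Sum>i. content (U i))"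
  unfolding content_def[of "\<Union>i. U i"]
proof (rule SUP_least, rule ennreal_le_epsilon)
  fix f and e :: real assume f: "f \<in> below S (\<Union>i. U i)" and e: "0 < e"
  obtain K g where K: "closedin S K" "K \<subseteq> (\<Union>i. U i)" and g: "g \<in> below S (\<Union>i. U i)"
    "\<And>x. x \<in> topspace S - K \<Longrightarrow> g x = 0" "\<Lambda> f \<le> \<Lambda> g + e"
    using truncation[OF f e] by blast
  have "compactin S K" using compact K(1) by (rule closedin_compact_space)
  then obtain F where F: "finite F" "F \<subseteq> range U" "K \<subseteq> \<Union>F"
    using K(2) U unfolding compactin_def by (metis (no_types, lifting) imageE)
  then obtain I where "finite I" "F = U ` I" by (meson finite_subset_image)
  moreover from this obtain N where "I \<subseteq> {..<N}" using finite_nat_iff_bounded by blast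
  ultimately have "K \<subseteq> (\<Union>i<N. U i)" using F by blast
  then have g': "g \<in> below S (\<Union>i<N. U i)" using g(1,2) by (auto simp: below_def)
  have "ennreal (\<Lambda> f) \<le> ennreal (\<Lambda> g + e)" using g(3) by (rule ennreal_leI)
  also have "\<dots> = ennreal (\<Lambda> g) + ennreal e" using below_nonneg[OF g'] e by (simp add: ennreal_plus)
  also have "\<dots> \<le> (\<Sum>i<N. content (U i)) + ennreal e"
    using content_upper[OF g'] content_UN_lessThan[of U N, OF U] by (intro add_right_mono) (rule order_trans)
  also have "\<dots> \<le> (\<Sum>i. content (U i)) + ennreal e"
    by (intro add_right_mono sum_le_suminf) auto
  finally show "ennreal (\<Lambda> f) \<le> (\<Sum>i. content (U i)) + ennreal e" .
qed

lemma outer_lower: "openin S U \<Longrightarrow> A \<subseteq> U \<Longrightarrow> outer A \<le> content U"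
  unfolding outer_def by (intro INF_lower) simp

lemma outer_open: "openin S U \<Longrightarrow> outer U = content U"
  by (intro antisym outer_lower) (auto simp: outer_def intro!: INF_greatest content_mono)

lemma outer_mono: "A \<subseteq> B \<Longrightarrow> outer A \<le> outer B"
  unfolding outer_def by (rule INF_superset_mono) auto

lemma outer_measure_space_outer: "outer_measure_space (Pow (topspace S)) outer"
  unfolding outer_measure_space_def
proof (intro conjI)
  show "positive (Pow (topspace S)) outer"
    by (simp add: positive_def outer_open content_empty)
  show "increasing (Pow (topspace S)) outer"
    by (auto simp: increasing_def outer_mono)
  show "countably_subadditive (Pow (topspace S)) outer"
    unfolding countably_subadditive_def
  proof (intro allI impI, rule ennreal_le_epsilon)
    fix A :: "nat \<Rightarrow> 'a set" and e :: real
    assume A: "range A \<subseteq> Pow (topspace S)" and e: "0 < e"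
    have fin: "outer (A i) \<noteq> \<infinity>" for i
    proof -
      have "outer (A i) \<le> content (topspace S)" using A by (intro outer_lower) auto
      then show ?thesis by (auto simp: content_space top_unique)
    qed
    \<comment> \<open>The errors e/2, e/4, ... add up to \<open>e\<close>. Finiteness of the outer
      measure makes approximation within a positive error possible.\<close>
    have "\<exists>U. openin S U \<and> A i \<subseteq> U \<and> content U \<le> outer (A i) + ennreal (e * (1/2)^Suc i)" for i
      using INF_approx_ennreal[of "e * (1/2)^Suc i" "outer (A i)", OF _ outer_def fin] e
      by (auto intro: less_imp_le)
    then obtain U where U: "\<And>i. openin S (U i)" "\<And>i. A i \<subseteq> U i"
      "\<And>i. content (U i) \<le> outer (A i) + ennreal (e * (1/2)^Suc i)" by metis
    have "outer (\<Union>i. A i) \<le> content (\<Union>i. U i)"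
      using U by (intro outer_lower) (auto simp: openin_Union)
    also have "\<dots> \<le> (\<Sum>i. content (U i))" using U by (intro content_UN)
    also have "\<dots> \<le> (\<Sum>i. outer (A i) + ennreal (e * (1/2)^Suc i))"
      using U by (intro suminf_le) auto
    also have "\<dots> = (\<Sum>i. outer (A i)) + (\<Sum>i. ennreal (e * (1/2)^Suc i))"
      by (intro suminf_add[symmetric]) auto
    also have "(\<Sum>i. ennreal (e * (1/2)^Suc i)) = ennreal e"
      using sums_mult[OF power_half_series, of e] e by (intro suminf_ennreal_eq) auto
    finally show "outer (\<Union>i. A i) \<le> (\<Sum>i. outer (A i)) + ennreal e" .
  qed
qed

text \<open>A function below \<open>V \<inter> U\<close> can be truncated to a \<open>g\<close> that
  vanishes off a closed \<open>K \<subseteq> V \<inter> U\<close>. The set \<open>V - K\<close> is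
  open and contains \<open>V - U\<close>, and any \<open>h\<close> below it has disjoint support
  from \<open>g\<close> in the sense that \<open>h\<close> vanishes on \<open>K\<close> and
  \<open>g\<close> off \<open>K\<close>. Hence the sum of \<open>h\<close> and \<open>g\<close> is
  still at most 1 and below \<open>V\<close>.\<close>

lemma content_split:
  assumes U: "openin S U" and V: "openin S V"
  shows "content (V \<inter> U) + outer (V - U) \<le> content V"
proof -
  have "ennreal (\<Lambda> f) + outer (V - U) \<le> content V + ennreal e"
    if f: "f \<in> below S (V \<inter> U)" and e: "0 < e" for f e
  proof -
    obtain K g where K: "closedin S K" "K \<subseteq> V \<inter> U" and g: "g \<in> below S (V \<inter> U)"
      "\<And>x. x \<in> topspace S - K \<Longrightarrow> g x = 0" "\<Lambda> f \<le> \<Lambda> g + e"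
      using truncation[OF f e] by blast
    have "ennreal (\<Lambda> h) + ennreal (\<Lambda> g) \<le> content V" if h: "h \<in> below S (V - K)" for h
    proof -
      have "h x + g x \<le> 1" if "x \<in> topspace S" for x
        using h g that by (cases "x \<in> K") (auto simp: below_def)
      moreover have "cont_real S (\<lambda>x. h x + g x)"
        using g(1) h by (intro continuous_intros) (auto simp: below_def)
      ultimately have "(\<lambda>x. h x + g x) \<in> below S V"
        using h g(1) by (auto simp: below_def)
      from content_upper[OF this] show ?thesis
        using add[of h g] g(1) h below_nonneg[OF g(1)] below_nonneg[OF h]
        by (simp add: below_def ennreal_plus)
    qed
    then have "(SUP h\<in>below S (V - K). ennreal (\<Lambda> h) + ennreal (\<Lambda> g)) \<le> content V"
      by (rule SUP_least)
    then have *: "content (V - K) + ennreal (\<Lambda> g) \<le> content V"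
      unfolding content_def[of "V - K"] using zero_in_below
      by (subst (asm) ennreal_SUP_add_left) auto
    have "outer (V - U) \<le> content (V - K)"
      using K V by (intro outer_lower openin_diff) auto
    moreover have "ennreal (\<Lambda> f) \<le> ennreal (\<Lambda> g) + ennreal e"
      using ennreal_leI[OF g(3)] below_nonneg[OF g(1)] e by (simp add: ennreal_plus)
    ultimately have "ennreal (\<Lambda> f) + outer (V - U) \<le> (ennreal (\<Lambda> g) + ennreal e) + content (V - K)"
      by (intro add_mono)
    also have "\<dots> = (content (V - K) + ennreal (\<Lambda> g)) + ennreal e" by (simp add: ac_simps)
    also have "\<dots> \<le> content V + ennreal e" using * by (rule add_right_mono)
    finally show ?thesis .
  qed
  then have "ennreal (\<Lambda> f) + outer (V - U) \<le> content V" if "f \<in> below S (V \<inter> U)" for f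
    by (rule ennreal_le_epsilon) (use that in blast)
  then have "(SUP f\<in>below S (V \<inter> U). ennreal (\<Lambda> f) + outer (V - U)) \<le> content V"
    by (rule SUP_least)
  moreover have "outer (V - U) \<noteq> \<top>"
    using order_trans[OF outer_lower[OF V, of "V - U"] content_le_1] by (auto simp: top_unique)
  ultimately show ?thesis
    unfolding content_def[of "V \<inter> U"] using zero_in_below
    by (subst (asm) ennreal_SUP_add_left) auto
qed

text \<open>In Caratheodory's criterion one inequality is subadditivity. For the other, the
  definition of \<open>outer\<close> allows the test set \<open>A\<close> to be enlarged to an open
  \<open>V\<close>, where \<open>content_split\<close> applies.\<close>

lemma open_in_lambda_system:
  assumes U: "openin S U"
  shows "U \<in> lambda_system (topspace S) (Pow (topspace S)) outer"
  unfolding algebra.lambda_system_eq[OF algebra_Pow]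
proof (intro CollectI conjI ballI)
  show "U \<in> Pow (topspace S)" using openin_subset[OF U] by simp
  fix A assume A: "A \<in> Pow (topspace S)"
  note oms = outer_measure_space_outer[unfolded outer_measure_space_def]
  have "subadditive (Pow (topspace S)) outer"
    using oms algebra_Pow[of "topspace S"]
    by (auto intro: ring_of_sets.countably_subadditive_subadditive simp: algebra_def)
  then have "outer (A \<inter> U \<union> (A - U)) \<le> outer (A \<inter> U) + outer (A - U)"
    using A by (intro subadditiveD[of "Pow (topspace S)" outer]) auto
  moreover have "A \<inter> U \<union> (A - U) = A" by auto
  moreover have "outer (A \<inter> U) + outer (A - U) \<le> content V" if V: "openin S V" "A \<subseteq> V" for V
  proof -
    have "outer (A \<inter> U) + outer (A - U) \<le> content (V \<inter> U) + outer (V - U)"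
      using V U by (intro add_mono outer_lower outer_mono) auto
    also have "\<dots> \<le> content V" using U V by (intro content_split)
    finally show ?thesis .
  qed
  then have "outer (A \<inter> U) + outer (A - U) \<le> outer A"
    unfolding outer_def[of A] by (intro INF_greatest) auto
  ultimately show "outer (A \<inter> U) + outer (A - U) = outer A" by simp
qed

section \<open>The representing measure and its regularity\<close>

definition representing :: "'a measure" where
  "representing = measure_of (topspace S) {U. openin S U} outer"

lemma space_representing: "space representing = topspace S"
  and sets_representing: "sets representing = sigma_sets (topspace S) {U. openin S U}"
  using openin_subset[of S]
  by (auto simp: representing_def space_measure_of_conv sets_measure_of_conv)

lemma emeasure_representing:
  assumes "A \<in> sets representing"
  shows "emeasure representing A = outer A"
proof (rule emeasure_measure_of[OF representing_def _ _ _ assms])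
  let ?L = "lambda_system (topspace S) (Pow (topspace S)) outer"
  have ms: "measure_space (topspace S) ?L outer"
    by (rule sigma_algebra.caratheodory_lemma[OF sigma_algebra_Pow outer_measure_space_outer])
  \<comment> \<open>Caratheodory's sets form a sigma-algebra containing the open sets, hence all
    Borel sets; the measure is the restriction to the latter.\<close>
  then have sub: "sets representing \<subseteq> ?L"
    unfolding sets_representing measure_space_def
    using open_in_lambda_system by (intro sigma_algebra.sigma_sets_subset) auto
  show "{U. openin S U} \<subseteq> Pow (topspace S)" using openin_subset[of S] by auto
  show "positive (sets representing) outer" "countably_additive (sets representing) outer"
    using ms sub by (auto simp: measure_space_def positive_def countably_additive_def)
qed

lemma prob_space_representing: "prob_space representing"
proof
  have "openin S (topspace S)" by simp
  then show "emeasure representing (space representing) = 1"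
    by (subst emeasure_representing) (auto simp: space_representing sets_representing outer_open content_space)
qed

text \<open>Outer regularity is the definition of \<open>outer\<close>. Inner regularity is outer
  regularity of the complement: the complement of an open set is closed, hence compact, and the
  total mass is 1.\<close>

lemma regular_representing: "regular_Borel_probability S representing"
  unfolding regular_Borel_probability_def
proof (intro conjI ballI)
  interpret prob_space representing by (rule prob_space_representing)
  show "space representing = topspace S"
    "sets representing = sigma_sets (topspace S) {U. openin S U}"
    "prob_space representing"
    by (fact space_representing sets_representing prob_space_representing)+
  fix A assume A: "A \<in> sets representing"
  have open_sets: "U \<in> sets representing" if "openin S U" for U
    using that by (simp add: sets_representing)
  have open_eq: "emeasure representing U = content U" if "openin S U" for U
    using that open_sets by (simp add: emeasure_representing outer_open)
  show "emeasure representing A = (INF U\<in>{U. openin S U \<and> A \<subseteq> U}. emeasure representing U)"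
    unfolding emeasure_representing[OF A] outer_def by (intro INF_cong) (auto simp: open_eq)
  show "emeasure representing A =
    (SUP K\<in>{K. compactin S K \<and> closedin S K \<and> K \<subseteq> A}. emeasure representing K)" (is "_ = ?sup")
  proof (rule antisym)
    show "?sup \<le> emeasure representing A"
      using A by (intro SUP_least emeasure_mono) auto
    show "emeasure representing A \<le> ?sup"
    proof (rule ennreal_le_epsilon)
      fix e :: real assume e: "0 < e"
      let ?B = "space representing - A"
      have B: "?B \<in> sets representing" using A by auto
      have "outer ?B \<noteq> \<infinity>" using emeasure_representing[OF B] emeasure_finite[of ?B] by simp
      then obtain U where U: "openin S U" "?B \<subseteq> U" "content U < outer ?B + ennreal e"
        using INF_approx_ennreal[OF e outer_def] by blast
      let ?K = "topspace S - U"
      \<comment> \<open>The estimate is moved to real numbers, where measures of complements are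
        differences from 1.\<close>
      have "ennreal (measure representing U) < ennreal (measure representing ?B + e)"
        using U(3) e by (simp add: open_eq[OF U(1), symmetric] emeasure_representing[OF B, symmetric]
            emeasure_eq_measure ennreal_plus)
      then have "measure representing U < measure representing ?B + e"
        by (simp add: ennreal_less_iff del: ennreal_plus)
      moreover have "measure representing ?K = 1 - measure representing U"
        using prob_compl[OF open_sets[OF U(1)]] by (simp add: space_representing)
      moreover have "measure representing ?B = 1 - measure representing A" by (rule prob_compl[OF A])
      ultimately have "emeasure representing A \<le> ennreal (measure representing ?K + e)"
        by (simp add: emeasure_eq_measure ennreal_leI)
      also have "\<dots> = emeasure representing ?K + ennreal e"
        using e by (simp add: emeasure_eq_measure ennreal_plus)
      also have "emeasure representing ?K \<le> ?sup"
      proof (rule SUP_upper)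
        have "closedin S ?K" using U(1) by auto
        then show "?K \<in> {K. compactin S K \<and> closedin S K \<and> K \<subseteq> A}"
          using U(2) closedin_compact_space[OF compact] by (auto simp: space_representing)
      qed
      finally show "emeasure representing A \<le> ?sup + ennreal e" by (simp add: add_right_mono)
    qed
  qed
qed

lemma functional_le_measure:
  assumes "f \<in> below S U" "openin S U"
  shows "\<Lambda> f \<le> measure representing U"
proof -
  interpret prob_space representing by (rule prob_space_representing)
  have "ennreal (\<Lambda> f) \<le> emeasure representing U"
    using content_upper[OF assms(1)] assms(2)
    by (simp add: emeasure_representing sets_representing outer_open)
  then show ?thesis by (simp add: emeasure_eq_measure)
qed

lemmas integrable_representing =
  regular_Borel_probability_integrable[OF compact regular_representing]

section \<open>Integration by horizontal slices\<close>

text \<open>The summand with index \<open>k\<close> is the part of \<open>y\<close> between the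
  heights \<open>k / N\<close> and (k + 1) / N; stacking the first \<open>n\<close> slices truncates
  \<open>y\<close> at height \<open>n / N\<close>.\<close>

lemma sum_layers:
  fixes y N :: real and n :: nat
  assumes "0 \<le> y" "0 < N"
  shows "(\<Sum>k<n. min (max (y - k / N) 0) (1 / N)) = min y (n / N)"
proof (induction n)
  case (Suc n)
  have *: "real (Suc n) / N = n / N + 1 / N" "0 < 1 / N" using assms by (simp_all add: add_divide_distrib)
  show ?case unfolding sum.lessThan_Suc Suc *(1) using *(2) by linarith
qed (use assms in simp)

text \<open>At most N y + 1 of the thresholds \<open>k / N\<close> lie strictly below
  \<open>y\<close>, and each contributes \<open>1 / N\<close>.\<close>

lemma sum_level_sets:
  fixes y N :: real and n :: nat
  assumes "0 \<le> y" "0 < N"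
  shows "(\<Sum>k<n. indicat_real {k / N<..} y / N) \<le> y + 1 / N"
proof (induction n)
  case 0
  then show ?case using assms by simp
next
  case (Suc n)
  show ?case
  proof (cases "y > n / N")
    case True
    \<comment> \<open>If \<open>y\<close> exceeds the last threshold, all \<open>Suc n\<close> terms
      are bounded crudely by \<open>1 / N\<close>; otherwise the last term is 0 and induction
      suffices.\<close>
    have "(\<Sum>k<Suc n. indicat_real {k / N<..} y / N) \<le> of_nat (card {..<Suc n}) * (1 / N)"
      using assms by (intro sum_bounded_above) (auto simp: indicator_def)
    also have "\<dots> \<le> y + 1 / N" using True assms by (simp add: field_simps)
    finally show ?thesis .
  qed (use Suc in simp)
qed

text \<open>Cut \<open>f\<close> into \<open>N\<close> slices of height \<open>1 / N\<close>. The
  slice above height \<open>k / N\<close>, multiplied by \<open>N\<close>, is below the open set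
  where \<open>f\<close> exceeds \<open>k / N\<close>, so \<Lambda> of the slice is at most the
  measure of that set divided by \<open>N\<close>. The level sets together overshoot the integral of
  \<open>f\<close> by at most \<open>1 / N\<close>.\<close>

lemma functional_le_integral_unit:
  assumes f: "cont_real S f" "\<And>x. x \<in> topspace S \<Longrightarrow> 0 \<le> f x \<and> f x \<le> 1"
  shows "\<Lambda> f \<le> integral\<^sup>L representing f"
proof (rule field_le_epsilon)
  interpret prob_space representing by (rule prob_space_representing)
  fix e :: real assume "0 < e"
  then obtain N :: nat where N: "0 < N" "1 / N < e"
    by (metis nat_approx_posE zero_less_Suc)
  let ?N = "real N"
  define F where "F k x = min (max (f x - k / ?N) 0) (1 / ?N)" for k x
  define U where "U k = {x \<in> topspace S. f x \<in> {k / ?N<..}}" for k :: nat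
  have cF: "cont_real S (F k)" for k
    unfolding F_def using f(1) by (intro continuous_intros) auto
  have U: "openin S (U k)" for k
    unfolding U_def using f(1) by (intro openin_continuous_map_preimage) auto
  then have Us: "U k \<in> sets representing" for k by (simp add: sets_representing)
  have F_le: "\<Lambda> (F k) \<le> measure representing (U k) / ?N" for k
  proof -
    have "cont_real S (\<lambda>x. ?N * F k x)" using cF by (intro continuous_intros)
    moreover have "0 \<le> F k x" "F k x \<le> 1 / ?N" for x using N by (auto simp: F_def)
    ultimately have "(\<lambda>x. ?N * F k x) \<in> below S (U k)"
      using N by (auto simp: below_def U_def field_simps) (auto simp: F_def min_def max_def field_simps split: if_splits)
    from functional_le_measure[OF this U] scale[OF cF] show ?thesis
      using N by (simp add: field_simps)
  qed
  have "\<Lambda> f = \<Lambda> (\<lambda>x. \<Sum>k<N. F k x)"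
  proof (rule cong[OF f(1)])
    show "cont_real S (\<lambda>x. \<Sum>k<N. F k x)" using cF by (intro continuous_intros) auto
    show "f x = (\<Sum>k<N. F k x)" if "x \<in> topspace S" for x
      using f(2)[OF that] N sum_layers[of "f x" ?N N] by (simp add: F_def)
  qed
  also have "\<dots> = (\<Sum>k<N. \<Lambda> (F k))" using cF by (intro sum) auto
  also have "\<dots> \<le> (\<Sum>k<N. measure representing (U k) / ?N)" by (intro sum_mono F_le)
  also have "\<dots> = (\<Sum>k<N. \<integral>x. indicat_real (U k) x / ?N \<partial>representing)"
    using Us by (intro sum.cong) auto
  also have "\<dots> = (\<integral>x. (\<Sum>k<N. indicat_real (U k) x / ?N) \<partial>representing)"
    using Us by (intro Bochner_Integration.integral_sum[symmetric]) (auto simp: less_top[symmetric])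
  also have "\<dots> \<le> (\<integral>x. f x + 1 / ?N \<partial>representing)"
  proof (rule integral_mono)
    show "integrable representing (\<lambda>x. \<Sum>k<N. indicat_real (U k) x / ?N)"
      using Us by (intro Bochner_Integration.integrable_sum) (auto simp: less_top[symmetric])
    show "integrable representing (\<lambda>x. f x + 1 / ?N)"
      using integrable_representing[OF f(1)] by simp
    fix x assume x: "x \<in> space representing"
    then have "(\<Sum>k<N. indicat_real (U k) x / ?N) = (\<Sum>k<N. indicat_real {k / ?N<..} (f x) / ?N)"
      by (intro sum.cong) (auto simp: U_def indicator_def space_representing)
    also have "\<dots> \<le> f x + 1 / ?N"
      using x f(2) N by (intro sum_level_sets) (auto simp: space_representing)
    finally show "(\<Sum>k<N. indicat_real (U k) x / ?N) \<le> f x + 1 / ?N" .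
  qed
  also have "\<dots> = integral\<^sup>L representing f + 1 / ?N"
    using integrable_representing[OF f(1)] by (simp add: prob_space)
  finally show "\<Lambda> f \<le> integral\<^sup>L representing f + e" using N(2) by simp
qed

text \<open>The one-sided estimate applied to both g and 1 - g gives equality for functions with
  values in the unit interval; linearity then covers all continuous functions.\<close>

lemma integral_representing:
  assumes f: "cont_real S f"
  shows "integral\<^sup>L representing f = \<Lambda> f"
proof -
  interpret prob_space representing by (rule prob_space_representing)
  have eq: "integral\<^sup>L representing g = \<Lambda> g"
    if g: "cont_real S g" "\<And>x. x \<in> topspace S \<Longrightarrow> 0 \<le> g x \<and> g x \<le> 1" for g
  proof (rule antisym)
    show "\<Lambda> g \<le> integral\<^sup>L representing g" using g by (rule functional_le_integral_unit)
    have "\<Lambda> (\<lambda>x. 1 - g x) \<le> integral\<^sup>L representing (\<lambda>x. 1 - g x)"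
      using g by (intro functional_le_integral_unit continuous_intros) auto
    then show "integral\<^sup>L representing g \<le> \<Lambda> g"
      using diff[of "\<lambda>_. 1" g] g integrable_representing[OF g(1)] one by (simp add: prob_space)
  qed
  obtain B where B: "0 < B" "\<And>x. x \<in> topspace S \<Longrightarrow> \<bar>f x\<bar> \<le> B"
    using cont_real_bounded[OF compact f] by blast
  \<comment> \<open>The affine map taking the interval from \<open>- B\<close> to \<open>B\<close>
    onto the unit interval.\<close>
  let ?g = "\<lambda>x. 1 / (2 * B) * f x + 1 / 2"
  have c: "cont_real S (\<lambda>x. 1 / (2 * B) * f x)"
    using f by (rule continuous_map_real_mult_left)
  have "integral\<^sup>L representing ?g = \<Lambda> ?g"
  proof (rule eq)
    show "cont_real S ?g" using c by (rule continuous_map_add) auto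
    show "0 \<le> ?g x \<and> ?g x \<le> 1" if "x \<in> topspace S" for x
      using B(1) B(2)[OF that] by (auto simp: field_simps abs_le_iff)
  qed
  moreover have "\<Lambda> ?g = 1 / (2 * B) * \<Lambda> f + 1 / 2"
  proof -
    have "\<Lambda> ?g = \<Lambda> (\<lambda>x. 1 / (2 * B) * f x) + \<Lambda> (\<lambda>_. 1 / 2)"
      using c by (rule add) auto
    then show ?thesis unfolding scale[OF f] const .
  qed
  moreover have "integral\<^sup>L representing ?g = 1 / (2 * B) * integral\<^sup>L representing f + 1 / 2"
    using integrable_representing[OF f] by (simp add: prob_space)
  ultimately show ?thesis using B(1) by simp
qed

theorem riesz_representation:
  "\<exists>\<omega>. regular_Borel_probability S \<omega> \<and> (\<forall>f. cont_real S f \<longrightarrow> integral\<^sup>L \<omega> f = \<Lambda> f)"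
  using regular_representing integral_representing by blast

end

section \<open>Extensions of a positive functional\<close>

text \<open>\<open>R \<psi> v\<close> demands that \<psi> have integral \<open>v\<close>. A relation
  avoids proving first that the value is well defined: if two values belong to the same function,
  their difference belongs to the zero function, and \<open>nonneg\<close> used in both directions
  makes it 0.\<close>

locale positive_moment_problem =
  fixes S :: "'a topology" and R :: "('a \<Rightarrow> real) \<Rightarrow> real \<Rightarrow> bool"
  assumes compact: "compact_space S" and Hausdorff: "Hausdorff_space S"
    and cont: "\<And>\<psi> v. R \<psi> v \<Longrightarrow> cont_real S \<psi>"
    and add: "\<And>\<psi> v \<psi>' v'. R \<psi> v \<Longrightarrow> R \<psi>' v' \<Longrightarrow> R (\<lambda>x. \<psi> x + \<psi>' x) (v + v')"
    and scale: "\<And>\<psi> v c. R \<psi> v \<Longrightarrow> R (\<lambda>x. c * \<psi> x) (c * v)"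
    and one: "R (\<lambda>_. 1) 1"
    and nonneg: "\<And>\<psi> v. R \<psi> v \<Longrightarrow> (\<And>x. x \<in> topspace S \<Longrightarrow> 0 \<le> \<psi> x) \<Longrightarrow> 0 \<le> v"
begin

definition solution :: "'a measure \<Rightarrow> bool" where
  "solution \<omega> \<longleftrightarrow> regular_Borel_probability S \<omega> \<and> (\<forall>\<psi> v. R \<psi> v \<longrightarrow> integral\<^sup>L \<omega> \<psi> = v)"

definition majorants :: "('a \<Rightarrow> real) \<Rightarrow> real set" where
  "majorants f = {v. \<exists>\<psi>. R \<psi> v \<and> (\<forall>x\<in>topspace S. f x \<le> \<psi> x)}"

definition upper :: "('a \<Rightarrow> real) \<Rightarrow> real" where
  "upper f = Inf (majorants f)"

lemma const: "R (\<lambda>_. c) c"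
  using scale[OF one, of c] by simp

lemma minus: "R \<psi> v \<Longrightarrow> R (\<lambda>x. - \<psi> x) (- v)"
  using scale[of \<psi> v "-1"] by simp

lemma majorants_nonempty: "cont_real S f \<Longrightarrow> majorants f \<noteq> {}"
  and majorants_bdd: "cont_real S f \<Longrightarrow> bdd_below (majorants f)"
proof -
  assume "cont_real S f"
  then obtain B where B: "\<And>x. x \<in> topspace S \<Longrightarrow> \<bar>f x\<bar> \<le> B"
    using cont_real_bounded[OF compact] by blast
  then have "f x \<le> B" "- B \<le> f x" if "x \<in> topspace S" for x
    using that abs_le_iff[of "f x" B] by (metis, metis minus_le_iff)
  note B = this
  then have "B \<in> majorants f" using const[of B] by (auto simp: majorants_def)
  then show "majorants f \<noteq> {}" by blast
  have "- B \<le> v" if v: "R \<psi> v" "\<And>x. x \<in> topspace S \<Longrightarrow> f x \<le> \<psi> x" for \<psi> v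
  proof -
    \<comment> \<open>Adding the constant \<open>B\<close> makes the majorant nonnegative, so
      positivity bounds its value from below.\<close>
    have "0 \<le> v + B" using B(2) v(2)
      by (intro nonneg[OF add[OF v(1) const[of B]]]) (smt (verit))
    then show ?thesis by simp
  qed
  then show "bdd_below (majorants f)"
    by (intro bdd_belowI[of _ "- B"]) (auto simp: majorants_def)
qed

lemma upper_le:
  "R \<psi> v \<Longrightarrow> cont_real S f \<Longrightarrow> (\<And>x. x \<in> topspace S \<Longrightarrow> f x \<le> \<psi> x) \<Longrightarrow> upper f \<le> v"
  unfolding upper_def using majorants_bdd by (intro cInf_lower) (auto simp: majorants_def)

lemma upper_greatest:
  "cont_real S f \<Longrightarrow> (\<And>\<psi> v. R \<psi> v \<Longrightarrow> (\<And>x. x \<in> topspace S \<Longrightarrow> f x \<le> \<psi> x) \<Longrightarrow> c \<le> v) \<Longrightarrow> c \<le> upper f"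
  unfolding upper_def using majorants_nonempty by (intro cInf_greatest) (auto simp: majorants_def)

lemma upper_approx:
  assumes "cont_real S f" "0 < e"
  obtains \<psi> v where "R \<psi> v" "\<And>x. x \<in> topspace S \<Longrightarrow> f x \<le> \<psi> x" "v < upper f + e"
proof -
  have "\<exists>v\<in>majorants f. v < upper f + e"
    using assms majorants_nonempty[of f] majorants_bdd[of f]
    by (intro cInf_lessD) (auto simp: upper_def)
  then show thesis by (auto simp: majorants_def intro: that)
qed

lemma function_space_cont_real: "function_space (Collect (cont_real S))"
  by (auto simp: function_space_def intro: continuous_map_add continuous_map_real_mult_left)

lemma sublinear_on_upper: "sublinear_on (Collect (cont_real S)) upper"
proof -
  have add_le: "upper (\<lambda>x. f x + g x) \<le> upper f + upper g"
    if f: "cont_real S f" and g: "cont_real S g" for f g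
  proof (rule field_le_epsilon)
    fix e :: real assume "0 < e"
    then have e2: "0 < e / 2" by simp
    obtain \<psi> v where \<psi>: "R \<psi> v" "\<And>x. x \<in> topspace S \<Longrightarrow> f x \<le> \<psi> x" "v < upper f + e / 2"
      using upper_approx[OF f e2] by blast
    obtain \<psi>' v' where \<psi>': "R \<psi>' v'" "\<And>x. x \<in> topspace S \<Longrightarrow> g x \<le> \<psi>' x" "v' < upper g + e / 2"
      using upper_approx[OF g e2] by blast
    have "upper (\<lambda>x. f x + g x) \<le> v + v'"
      using \<psi> \<psi>' f g by (intro upper_le[OF add] continuous_map_add add_mono) auto
    then show "upper (\<lambda>x. f x + g x) \<le> upper f + upper g + e"
      using \<psi>(3) \<psi>'(3) by simp
  qed
  have scale_le: "c * upper f \<le> upper (\<lambda>x. c * f x)" if "0 < c" "cont_real S f" for c f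
  proof (rule upper_greatest)
    show "cont_real S (\<lambda>x. c * f x)" using that(2) by (rule continuous_map_real_mult_left)
    fix \<psi> v assume \<psi>: "R \<psi> v" "\<And>x. x \<in> topspace S \<Longrightarrow> c * f x \<le> \<psi> x"
    have "upper f \<le> 1 / c * v"
      using that \<psi>(2) by (intro upper_le[OF scale[OF \<psi>(1)]]) (auto simp: field_simps)
    then show "c * upper f \<le> v" using that(1) by (simp add: field_simps)
  qed
  have scale_eq: "upper (\<lambda>x. c * f x) = c * upper f" if "0 < c" "cont_real S f" for c f
  proof (rule antisym)
    \<comment> \<open>The reverse inequality is \<open>scale_le\<close> for the factor
      \<open>1 / c\<close> and the already scaled function.\<close>
    have "1 / c * upper (\<lambda>x. c * f x) \<le> upper (\<lambda>x. 1 / c * (c * f x))"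
      using that by (intro scale_le continuous_map_real_mult_left) auto
    then show "upper (\<lambda>x. c * f x) \<le> c * upper f" using that(1) by (simp add: field_simps)
  qed (use scale_le that in auto)
  have "upper (\<lambda>_. 0) = 0"
  proof (rule antisym)
    show "upper (\<lambda>_. 0) \<le> 0" by (rule upper_le[OF const[of 0]]) auto
    show "0 \<le> upper (\<lambda>_. 0)" by (rule upper_greatest) (auto intro: nonneg)
  qed
  then have "upper (\<lambda>x. c * f x) = c * upper f" if "0 \<le> c" "cont_real S f" for c f
    using scale_eq[of c f] that by (cases "c = 0") auto
  with add_le show ?thesis by (simp add: sublinear_on_def)
qed

text \<open>A linear functional below \<open>upper\<close> is automatically positive, since 0
  majorizes every nonpositive function, and it respects \<open>R\<close>, since a function related
  to \<open>v\<close> and its negative are majorants of themselves.\<close>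

theorem solution_attaining_upper:
  assumes f: "cont_real S f"
  obtains \<omega> where "solution \<omega>" "integral\<^sup>L \<omega> f = upper f"
proof -
  obtain \<Lambda> where \<Lambda>: "\<And>f g. cont_real S f \<Longrightarrow> cont_real S g \<Longrightarrow> \<Lambda> (\<lambda>x. f x + g x) = \<Lambda> f + \<Lambda> g"
    "\<And>c f. cont_real S f \<Longrightarrow> \<Lambda> (\<lambda>x. c * f x) = c * \<Lambda> f"
    "\<And>f. cont_real S f \<Longrightarrow> \<Lambda> f \<le> upper f" "\<Lambda> f = upper f"
    using hahn_banach_attaining[OF function_space_cont_real sublinear_on_upper, of f] f
    by auto
  have \<Lambda>_minus: "\<Lambda> (\<lambda>x. - g x) = - \<Lambda> g" if "cont_real S g" for g
    using \<Lambda>(2)[OF that, of "-1"] by simp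
  have \<Lambda>_R: "\<Lambda> \<psi> = v" if \<psi>: "R \<psi> v" for \<psi> v
  proof (rule antisym)
    show "\<Lambda> \<psi> \<le> v"
      using \<Lambda>(3)[OF cont[OF \<psi>]] upper_le[OF \<psi> cont[OF \<psi>]] by simp
    show "v \<le> \<Lambda> \<psi>"
      using \<Lambda>(3)[OF cont[OF minus[OF \<psi>]]] upper_le[OF minus[OF \<psi>] cont[OF minus[OF \<psi>]]]
        \<Lambda>_minus[OF cont[OF \<psi>]] by simp
  qed
  interpret \<Lambda>: normalized_positive_functional S \<Lambda>
  proof
    show "0 \<le> \<Lambda> g" if "cont_real S g" "\<And>x. x \<in> topspace S \<Longrightarrow> 0 \<le> g x" for g
    proof -
      have m: "cont_real S (\<lambda>x. - g x)" using that(1) by (rule continuous_map_minus)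
      have "\<Lambda> (\<lambda>x. - g x) \<le> 0"
        using \<Lambda>(3)[OF m] upper_le[OF const[of 0] m] that(2) by simp
      then show ?thesis using \<Lambda>_minus[OF that(1)] by simp
    qed
  qed (use compact Hausdorff \<Lambda> \<Lambda>_R[OF one] in auto)
  obtain \<omega> where "regular_Borel_probability S \<omega>" "\<And>f. cont_real S f \<Longrightarrow> integral\<^sup>L \<omega> f = \<Lambda> f"
    using \<Lambda>.riesz_representation by blast
  then show thesis using f \<Lambda>(4) \<Lambda>_R cont by (intro that[of \<omega>]) (auto simp: solution_def)
qed

lemma solution_exists: "\<exists>\<omega>. solution \<omega>"
proof -
  have "cont_real S (\<lambda>_. 0)" by simp
  then show ?thesis using solution_attaining_upper by blast
qed

theorem unique_solution_iff:
  "(\<exists>!\<omega>. solution \<omega>) \<longleftrightarrow>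
   (\<forall>\<phi> \<epsilon>. cont_real S \<phi> \<and> 0 < \<epsilon> \<longrightarrow>
     (\<exists>\<psi>\<^sub>m v\<^sub>m \<psi>\<^sub>p v\<^sub>p. R \<psi>\<^sub>m v\<^sub>m \<and> R \<psi>\<^sub>p v\<^sub>p \<and>
       (\<forall>x\<in>topspace S. \<psi>\<^sub>m x \<le> \<phi> x \<and> \<phi> x \<le> \<psi>\<^sub>p x) \<and> v\<^sub>p - v\<^sub>m \<le> \<epsilon>))"
  (is "?unique \<longleftrightarrow> ?sandwich")
proof
  assume unique: ?unique
  show ?sandwich
  proof (intro allI impI, elim conjE)
    fix \<phi> and \<epsilon> :: real assume \<phi>: "cont_real S \<phi>" and \<epsilon>: "0 < \<epsilon>"
    have m\<phi>: "cont_real S (\<lambda>x. - \<phi> x)" using \<phi> by (rule continuous_map_minus)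
    obtain \<omega> where \<omega>: "solution \<omega>" "integral\<^sup>L \<omega> \<phi> = upper \<phi>"
      using solution_attaining_upper[OF \<phi>] by blast
    obtain \<omega>' where \<omega>': "solution \<omega>'" "integral\<^sup>L \<omega>' (\<lambda>x. - \<phi> x) = upper (\<lambda>x. - \<phi> x)"
      using solution_attaining_upper[OF m\<phi>] by blast
    have "\<omega>' = \<omega>" using unique \<omega>(1) \<omega>'(1) by blast
    \<comment> \<open>One and the same measure attains both extreme values, so the least value from
      above meets the greatest value from below; near-optimal majorants of \<phi> and of its
      negative then enclose \<phi> with a gap below \<epsilon>.\<close>
    then have eq: "upper (\<lambda>x. - \<phi> x) = - upper \<phi>" using \<omega>(2) \<omega>'(2) by simp
    have \<epsilon>2: "0 < \<epsilon> / 2" using \<epsilon> by simp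
    obtain \<psi> v where \<psi>: "R \<psi> v" "\<And>x. x \<in> topspace S \<Longrightarrow> \<phi> x \<le> \<psi> x" "v < upper \<phi> + \<epsilon> / 2"
      using upper_approx[OF \<phi> \<epsilon>2] by blast
    obtain \<psi>' v' where \<psi>': "R \<psi>' v'" "\<And>x. x \<in> topspace S \<Longrightarrow> - \<phi> x \<le> \<psi>' x"
      "v' < upper (\<lambda>x. - \<phi> x) + \<epsilon> / 2"
      using upper_approx[OF m\<phi> \<epsilon>2] by blast
    have "- \<psi>' x \<le> \<phi> x \<and> \<phi> x \<le> \<psi> x" if "x \<in> topspace S" for x
      using \<psi>(2)[OF that] \<psi>'(2)[OF that] by simp
    moreover have "v - (- v') \<le> \<epsilon>" using \<psi>(3) \<psi>'(3) eq by simp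
    ultimately show "\<exists>\<psi>\<^sub>m v\<^sub>m \<psi>\<^sub>p v\<^sub>p. R \<psi>\<^sub>m v\<^sub>m \<and> R \<psi>\<^sub>p v\<^sub>p \<and>
       (\<forall>x\<in>topspace S. \<psi>\<^sub>m x \<le> \<phi> x \<and> \<phi> x \<le> \<psi>\<^sub>p x) \<and> v\<^sub>p - v\<^sub>m \<le> \<epsilon>"
      using minus[OF \<psi>'(1)] \<psi>(1) by blast
  qed
next
  assume sandwich: ?sandwich
  have le: "integral\<^sup>L \<omega> \<phi> \<le> integral\<^sup>L \<omega>' \<phi>"
    if sol: "solution \<omega>" "solution \<omega>'" and \<phi>: "cont_real S \<phi>" for \<omega> \<omega>' \<phi>
  proof (rule field_le_epsilon)
    fix \<epsilon> :: real assume "0 < \<epsilon>"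
    then obtain \<psi>\<^sub>m v\<^sub>m \<psi>\<^sub>p v\<^sub>p where R: "R \<psi>\<^sub>m v\<^sub>m" "R \<psi>\<^sub>p v\<^sub>p"
      and \<psi>: "\<And>x. x \<in> topspace S \<Longrightarrow> \<psi>\<^sub>m x \<le> \<phi> x \<and> \<phi> x \<le> \<psi>\<^sub>p x" and v: "v\<^sub>p - v\<^sub>m \<le> \<epsilon>"
      using sandwich \<phi> by metis
    have reg: "regular_Borel_probability S \<omega>" "regular_Borel_probability S \<omega>'"
      using sol by (auto simp: solution_def)
    then have sp: "space \<omega> = topspace S" "space \<omega>' = topspace S"
      by (auto simp: regular_Borel_probability_def)
    note int = regular_Borel_probability_integrable[OF compact]
    have "integral\<^sup>L \<omega> \<phi> \<le> integral\<^sup>L \<omega> \<psi>\<^sub>p"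
      using \<psi> R \<phi> reg sp by (intro integral_mono int) (auto intro: cont)
    also have "\<dots> \<le> integral\<^sup>L \<omega>' \<psi>\<^sub>m + \<epsilon>"
      using sol R v by (auto simp: solution_def)
    also have "integral\<^sup>L \<omega>' \<psi>\<^sub>m \<le> integral\<^sup>L \<omega>' \<phi>"
      using \<psi> R \<phi> reg sp by (intro integral_mono int) (auto intro: cont)
    finally show "integral\<^sup>L \<omega> \<phi> \<le> integral\<^sup>L \<omega>' \<phi> + \<epsilon>" by simp
  qed
  show ?unique
  proof (rule ex_ex1I)
    show "\<exists>\<omega>. solution \<omega>" by (rule solution_exists)
    fix \<omega> \<omega>' assume sol: "solution \<omega>" "solution \<omega>'"
    show "\<omega> = \<omega>'"
    proof (rule regular_Borel_probability_eqI[OF compact Hausdorff])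
      show "regular_Borel_probability S \<omega>" "regular_Borel_probability S \<omega>'"
        using sol by (auto simp: solution_def)
      show "integral\<^sup>L \<omega> f = integral\<^sup>L \<omega>' f" if "cont_real S f" for f
        using le[OF sol that] le[OF sol(2,1) that] by simp
    qed
  qed
qed

end

section \<open>Type spaces\<close>

lemma tval_cong: "(\<And>v. v \<in> fv_tm t \<Longrightarrow> a v = b v) \<Longrightarrow> tval M a t = tval M b t"
proof (induction t)
  case (Fn f ts)
  then have "map (tval M a) ts = map (tval M b) ts" by (intro map_cong) auto
  then show ?case by (simp del: map_eq_conv)
qed auto

lemma fval_cong: "(\<And>v. v \<in> fv \<phi> \<Longrightarrow> a v = b v) \<Longrightarrow> fval L M \<phi> a = fval L M \<phi> b"
proof (induction \<phi> arbitrary: a b)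
  case (Dist s t u)
  then have "tval M a t = tval M b t" "tval M a u = tval M b u" by (auto intro!: tval_cong)
  then show ?case by simp
next
  case (Pred P ts)
  have "map (tval M a) ts = map (tval M b) ts"
    using Pred by (intro map_cong tval_cong) auto
  then show ?case by (simp del: map_eq_conv)
next
  case (Conn u \<phi>s)
  have "map (\<lambda>\<phi>. fval L M \<phi> a) \<phi>s = map (\<lambda>\<phi>. fval L M \<phi> b) \<phi>s"
  proof (intro map_cong refl)
    fix \<phi> assume "\<phi> \<in> set \<phi>s"
    moreover from this have "a v = b v" if "v \<in> fv \<phi>" for v using Conn.prems that by auto
    ultimately show "fval L M \<phi> a = fval L M \<phi> b" by (rule Conn.IH)
  qed
  then show ?case by (simp add: comp_def del: map_eq_conv)
next
  case (SupQ v \<phi>)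
  have "fval L M \<phi> (a(v := m)) = fval L M \<phi> (b(v := m))" for m
    using SupQ.prems by (intro SupQ.IH) auto
  then show ?case by simp
next
  case (InfQ v \<phi>)
  have "fval L M \<phi> (a(v := m)) = fval L M \<phi> (b(v := m))" for m
    using InfQ.prems by (intro InfQ.IH) auto
  then show ?case by simp
qed

lemma tval_in_univ:
  assumes M: "metric_structure L M" and a: "a \<in> assignments L M"
  shows "wf_tm L (univ M) t s \<Longrightarrow> tval M a t \<in> univ M s"
proof (induction rule: wf_tm.induct)
  case (3 ts f s)
  then have "map (tval M a) ts \<in> args M (fdom L f)"
    by (auto simp: args_def list_all2_conv_all_nth)
  then show ?case using M 3 by (auto simp: metric_structure_def)
qed (use a in \<open>auto simp: assignments_def\<close>)

text \<open>Real suprema and infima are informative only over nonempty bounded sets, so in the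
  quantifier cases the bound must already be known for every changed assignment.\<close>

lemma fval_in_unit:
  assumes M: "metric_structure L M"
  shows "wf_fm L (univ M) \<phi> \<Longrightarrow> a \<in> assignments L M \<Longrightarrow> fval L M \<phi> a \<in> {0..1}"
proof (induction arbitrary: a rule: wf_fm.induct)
  case (1 t s u)
  interpret Metric_space "univ M s" "mdist M s"
    using M by (simp add: metric_structure_def)
  show ?case
    using M tval_in_univ[OF M 1(3)] 1(1,2) by (simp add: metric_structure_def)
next
  case (2 ts P)
  then have "map (tval M a) ts \<in> args M (pdom L P)"
    using tval_in_univ[OF M 2(2)] by (auto simp: args_def list_all2_conv_all_nth)
  then have "pint M P (map (tval M a) ts) \<in> {0..1}"
    using M unfolding metric_structure_def by blast
  then show ?case by simp
next
  case (3 \<phi>s u)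
  then have "map (\<lambda>g. g a) (map (fval L M) \<phi>s) \<in> cube (length \<phi>s)"
    by (auto simp: cube_def list_all_iff)
  then have "u (map (\<lambda>g. g a) (map (fval L M) \<phi>s)) \<in> {0..1}"
    using 3(1) unfolding connective_def by blast
  then show ?case by simp
next
  case (4 \<phi> v)
  have ne: "univ M (vsort L v) \<noteq> {}" using M by (simp add: metric_structure_def)
  have in01: "fval L M \<phi> (a(v := m)) \<in> {0..1}" if "m \<in> univ M (vsort L v)" for m
    using 4 that by (intro 4) (auto simp: assignments_def)
  obtain m where m: "m \<in> univ M (vsort L v)" using ne by blast
  have "fval L M \<phi> (a(v := m)) \<le> (SUP m\<in>univ M (vsort L v). fval L M \<phi> (a(v := m)))"
    using in01 m by (intro cSUP_upper) (auto intro!: bdd_aboveI[of _ 1])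
  moreover have "(SUP m\<in>univ M (vsort L v). fval L M \<phi> (a(v := m))) \<le> 1"
    using in01 ne by (intro cSUP_least) auto
  ultimately show ?case using in01[OF m] by simp
next
  case (5 \<phi> v)
  have ne: "univ M (vsort L v) \<noteq> {}" using M by (simp add: metric_structure_def)
  have in01: "fval L M \<phi> (a(v := m)) \<in> {0..1}" if "m \<in> univ M (vsort L v)" for m
    using 5 that by (intro 5) (auto simp: assignments_def)
  obtain m where m: "m \<in> univ M (vsort L v)" using ne by blast
  have "(INF m\<in>univ M (vsort L v). fval L M \<phi> (a(v := m))) \<le> fval L M \<phi> (a(v := m))"
    using in01 m by (intro cINF_lower) (auto intro!: bdd_belowI[of _ 0])
  moreover have "0 \<le> (INF m\<in>univ M (vsort L v). fval L M \<phi> (a(v := m)))"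
    using in01 ne by (intro cINF_greatest) auto
  ultimately show ?case using in01[OF m] by simp
qed

section \<open>The type space as a compact Hausdorff space\<close>

text \<open>The type over \<open>M\<close> of a tuple from \<open>M\<close> itself.\<close>

definition realized_type ::
  "('f, 'p, 'v, 's) language \<Rightarrow> ('f, 'p, 's, 'm) mstruct \<Rightarrow> 'v set \<Rightarrow> ('v \<Rightarrow> 'm) \<Rightarrow>
   (('f, 'p, 'v, 's, 'm) fm \<Rightarrow> real)" where
  "realized_type L M x a = (\<lambda>\<phi>\<in>formulas L M x. fval L M \<phi> a)"

lemma realized_type_in_complete_types:
  "a \<in> assignments L M \<Longrightarrow> realized_type L M x a \<in> complete_types L M x"
  by (auto simp: complete_types_def realized_type_def subset_eq intro!: bexI[of _ a])

lemma complete_types_in_unit: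
  assumes M: "metric_structure L M" and p: "p \<in> complete_types L M x" and \<phi>: "\<phi> \<in> formulas L M x"
  shows "p \<phi> \<in> {0..1}"
proof -
  have "\<exists>r\<in>{0..1}. \<bar>r - p \<phi>\<bar> < e" if "0 < e" for e
  proof -
    have "\<exists>a\<in>assignments L M. \<forall>\<phi>\<in>{\<phi>}. \<bar>fval L M \<phi> a - p \<phi>\<bar> < e"
      using p \<phi> that unfolding complete_types_def by blast
    then show ?thesis using fval_in_unit[OF M] \<phi> by (auto simp: formulas_def)
  qed
  note approx = this
  show ?thesis
  proof (rule ccontr)
    assume "p \<phi> \<notin> {0..1}"
    then consider "0 < - p \<phi>" | "0 < p \<phi> - 1" by force
    then show False
    proof cases
      case 1 from approx[OF this] show ?thesis using 1 by auto
    next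
      case 2 from approx[OF this] show ?thesis using 2 by auto
    qed
  qed
qed

lemma topspace_type_space [simp]: "topspace (type_space L M x) = complete_types L M x"
  by (auto simp: type_space_def complete_types_def PiE_def)

lemma Hausdorff_type_space: "Hausdorff_space (type_space L M x)"
  by (simp add: type_space_def Hausdorff_space_subtopology Hausdorff_space_product_topology)

lemma cont_real_eval: "\<phi> \<in> formulas L M x \<Longrightarrow> cont_real (type_space L M x) (\<lambda>p. p \<phi>)"
  unfolding type_space_def
  by (rule continuous_map_from_subtopology) (rule continuous_map_product_projection)

text \<open>Each instance of approximate satisfiability involves finitely many formulas, hence
  finitely many coordinates, and so passes to limit points.\<close>

lemma closedin_complete_types:
  "closedin (product_topology (\<lambda>_. euclideanreal) (formulas L M x)) (complete_types L M x)"
  (is "closedin ?P ?T")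
  unfolding closure_of_subset_eq[symmetric]
proof
  show "?T \<subseteq> topspace ?P" by (auto simp: complete_types_def PiE_def)
  show "?P closure_of ?T \<subseteq> ?T"
  proof
    fix p assume p: "p \<in> ?P closure_of ?T"
    then have "p \<in> extensional (formulas L M x)" by (auto simp: in_closure_of PiE_def)
    moreover have "\<exists>a\<in>assignments L M. \<forall>\<phi>\<in>F. \<bar>fval L M \<phi> a - p \<phi>\<bar> < e"
      if F: "finite F" "F \<subseteq> formulas L M x" "0 < e" for F and e :: real
    proof -
      \<comment> \<open>Half of the tolerance is spent on moving from \<open>p\<close> to a type
        \<open>q\<close> nearby, half on realizing \<open>q\<close> in \<open>M\<close>.\<close>
      define U where "U = topspace ?P \<inter> (\<Inter>\<phi>\<in>F. {q \<in> topspace ?P. q \<phi> \<in> ball (p \<phi>) (e / 2)})"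
      have "openin ?P U"
        unfolding U_def
      proof (intro openin_Int_Inter openin_topspace)
        show "openin ?P K" if K: "K \<in> (\<lambda>\<phi>. {q \<in> topspace ?P. q \<phi> \<in> ball (p \<phi>) (e / 2)}) ` F" for K
        proof -
          obtain \<phi> where "\<phi> \<in> formulas L M x" "K = {q \<in> topspace ?P. q \<phi> \<in> ball (p \<phi>) (e / 2)}"
            using K F by blast
          then show ?thesis
            using openin_continuous_map_preimage[OF continuous_map_product_projection, of \<phi> "formulas L M x"
                "\<lambda>_. euclideanreal" "ball (p \<phi>) (e / 2)"] by simp
        qed
      qed (use F in simp)
      moreover have "p \<in> U" using p F by (auto simp: U_def in_closure_of)
      ultimately obtain q where q: "q \<in> ?T" "q \<in> U" using p by (auto simp: in_closure_of)
      then obtain a where a: "a \<in> assignments L M" "\<And>\<phi>. \<phi> \<in> F \<Longrightarrow> \<bar>fval L M \<phi> a - q \<phi>\<bar> < e / 2"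
        using F unfolding complete_types_def by (auto dest!: spec[of _ F] spec[of _ "e / 2"])
      have "\<bar>fval L M \<phi> a - p \<phi>\<bar> < e" if "\<phi> \<in> F" for \<phi>
      proof -
        have "\<bar>p \<phi> - q \<phi>\<bar> < e / 2" using q(2) that by (auto simp: U_def dist_real_def)
        then show ?thesis using a(2)[OF that] by linarith
      qed
      then show ?thesis using a(1) by blast
    qed
    ultimately show "p \<in> ?T" unfolding complete_types_def by blast
  qed
qed

text \<open>Since types are given by approximate satisfiability in \<open>M\<close>, Tychonoff's
  theorem takes the place of the compactness theorem of the logic: the types form a closed subset of
  a power of the unit interval.\<close>

lemma compact_type_space:
  assumes "metric_structure L M"
  shows "compact_space (type_space L M x)"
  unfolding type_space_def
proof (intro compact_space_subtopology closed_compactin[OF _ _ closedin_complete_types])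
  show "compactin (product_topology (\<lambda>_. euclideanreal) (formulas L M x)) (\<Pi>\<^sub>E \<phi>\<in>formulas L M x. {0..1})"
    by (simp add: compactin_PiE)
  show "complete_types L M x \<subseteq> (\<Pi>\<^sub>E \<phi>\<in>formulas L M x. {0..1})"
  proof
    fix p assume p: "p \<in> complete_types L M x"
    then have "p \<in> extensional (formulas L M x)" by (simp add: complete_types_def)
    then show "p \<in> (\<Pi>\<^sub>E \<phi>\<in>formulas L M x. {0..1})"
      using complete_types_in_unit[OF assms p] unfolding PiE_iff by blast
  qed
qed

lemma formulas_mono: "y \<subseteq> x \<Longrightarrow> formulas L M y \<subseteq> formulas L M x"
  by (auto simp: formulas_def)

section \<open>Restriction to subtuples and common extensions\<close>

lemma restrict_type_in_complete_types:
  assumes "y \<subseteq> x" "p \<in> complete_types L M x"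
  shows "restrict_type L M y p \<in> complete_types L M y"
proof -
  have "\<exists>a\<in>assignments L M. \<forall>\<phi>\<in>F. \<bar>fval L M \<phi> a - restrict_type L M y p \<phi>\<bar> < e"
    if F: "finite F" "F \<subseteq> formulas L M y" "0 < e" for F and e :: real
  proof -
    have "F \<subseteq> formulas L M x" using F formulas_mono[OF assms(1)] by blast
    then obtain a where "a \<in> assignments L M" "\<forall>\<phi>\<in>F. \<bar>fval L M \<phi> a - p \<phi>\<bar> < e"
      using F assms(2) unfolding complete_types_def by blast
    then show ?thesis using F by (auto simp: restrict_type_def intro!: bexI[of _ a])
  qed
  then show ?thesis by (simp add: complete_types_def) (simp add: restrict_type_def)
qed

lemma continuous_map_restrict_type:
  assumes "y \<subseteq> x"
  shows "continuous_map (type_space L M x) (type_space L M y) (restrict_type L M y)"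
proof -
  have "cont_real (type_space L M x) (\<lambda>p. restrict_type L M y p \<phi>)" if "\<phi> \<in> formulas L M y" for \<phi>
    using cont_real_eval[of \<phi> L M x] that formulas_mono[OF assms] by (auto simp: restrict_type_def)
  moreover have "restrict_type L M y p \<in> extensional (formulas L M y)" for p
    by (simp add: restrict_type_def)
  ultimately have "continuous_map (type_space L M x)
      (product_topology (\<lambda>_. euclideanreal) (formulas L M y)) (restrict_type L M y)"
    by (auto simp: continuous_map_componentwise)
  then show ?thesis
    using restrict_type_in_complete_types[OF assms]
    by (subst (2) type_space_def) (auto intro!: continuous_map_into_subtopology)
qed

lemma cont_real_compose_restrict_type:
  assumes "y \<subseteq> x" "definable_predicate L M y \<psi>"
  shows "cont_real (type_space L M x) (\<lambda>p. \<psi> (restrict_type L M y p))"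
  using continuous_map_compose[OF continuous_map_restrict_type[OF assms(1)]] assms(2)
  by (simp add: definable_predicate_def comp_def)

text \<open>By compactness it is enough to meet finitely many approximate conditions. Those coming
  from one \<open>q i\<close> are met by an assignment in \<open>M\<close>; as the tuples are
  disjoint, these assignments can be glued into one, and each formula sees only its own
  tuple.\<close>

lemma restrict_type_jointly_surj:
  assumes M: "metric_structure L M" and I: "finite I" and disj: "disjoint_family_on x I"
    and q: "\<And>i. i \<in> I \<Longrightarrow> q i \<in> complete_types L M (x i)"
  obtains p where "p \<in> complete_types L M (\<Union>i\<in>I. x i)"
    "\<And>i. i \<in> I \<Longrightarrow> restrict_type L M (x i) p = q i"
proof -
  let ?x = "\<Union>i\<in>I. x i"
  let ?S = "type_space L M ?x"
  define C where "C = (\<lambda>(i, \<phi>, e). {p \<in> topspace ?S. p \<phi> \<in> cball (q i \<phi>) e})"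
  define J where "J = {(i, \<phi>, e). i \<in> I \<and> \<phi> \<in> formulas L M (x i) \<and> (0::real) < e}"
  have sub: "formulas L M (x i) \<subseteq> formulas L M ?x" if "i \<in> I" for i
    using that by (intro formulas_mono) auto
  \<comment> \<open>The whole space is included so that a point of the intersection is a type even
    if \<open>J\<close> is empty.\<close>
  have "\<Inter>(insert (topspace ?S) (C ` J)) \<noteq> {}"
  proof (rule compact_space_fip[THEN iffD1, OF compact_type_space[OF M], rule_format])
    show "(\<forall>K\<in>insert (topspace ?S) (C ` J). closedin ?S K) \<and>
      (\<forall>F. finite F \<and> F \<subseteq> insert (topspace ?S) (C ` J) \<longrightarrow> \<Inter>F \<noteq> {})"
    proof (intro conjI ballI allI impI)
      fix K assume "K \<in> insert (topspace ?S) (C ` J)"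
      then consider "K = topspace ?S"
        | i \<phi> e where "i \<in> I" "\<phi> \<in> formulas L M (x i)" "K = C (i, \<phi>, e)"
        by (auto simp: J_def)
      then show "closedin ?S K"
      proof cases
        case 2
        then have "cont_real ?S (\<lambda>p. p \<phi>)" using sub by (intro cont_real_eval) auto
        from closedin_continuous_map_preimage[OF this, of "cball (q i \<phi>) e"] 2(3)
        show ?thesis by (simp add: C_def)
      qed (use closedin_topspace in blast)
    next
      fix F assume F: "finite F \<and> F \<subseteq> insert (topspace ?S) (C ` J)"
      then have "finite (F - {topspace ?S})" "F - {topspace ?S} \<subseteq> C ` J" by auto
      then obtain J' where J': "finite J'" "J' \<subseteq> J" "F - {topspace ?S} = C ` J'"
        by (meson finite_subset_image)
      \<comment> \<open>One tolerance serves all the finitely many conditions; the extra 1 keeps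
        \<open>Min\<close> meaningful when there are none.\<close>
      define \<delta> where "\<delta> = Min (insert 1 ((\<lambda>(i, \<phi>, e). e) ` J'))"
      have "0 < e" if "(i, \<phi>, e) \<in> J'" for i \<phi> e
        using that J'(2) by (auto simp: J_def)
      then have \<delta>: "0 < \<delta>"
        using J'(1) by (auto simp: \<delta>_def)
      have \<delta>_le: "\<delta> \<le> e" if "(i, \<phi>, e) \<in> J'" for i \<phi> e
        unfolding \<delta>_def using that J'(1) by (intro Min_le) force+
      define G where "G i = {\<phi>. \<exists>e. (i, \<phi>, e) \<in> J'}" for i
      have "G i \<subseteq> (\<lambda>(i, \<phi>, e). \<phi>) ` J'" for i by (force simp: G_def)
      then have G: "finite (G i)" for i using J'(1) by (meson finite_imageI finite_subset)
      have "\<exists>a\<in>assignments L M. \<forall>\<phi>\<in>G i. \<bar>fval L M \<phi> a - q i \<phi>\<bar> < \<delta>" if "i \<in> I" for i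
      proof -
        have "G i \<subseteq> formulas L M (x i)" using J'(2) by (auto simp: G_def J_def)
        then show ?thesis using G \<delta> q[OF that] unfolding complete_types_def by blast
      qed
      then obtain a where a: "\<And>i. i \<in> I \<Longrightarrow> a i \<in> assignments L M"
        "\<And>i \<phi>. i \<in> I \<Longrightarrow> \<phi> \<in> G i \<Longrightarrow> \<bar>fval L M \<phi> (a i) - q i \<phi>\<bar> < \<delta>"
        by metis
      have "\<exists>b. b \<in> assignments L M"
      proof -
        have "\<forall>v. \<exists>m. m \<in> univ M (vsort L v)" using M by (auto simp: metric_structure_def)
        then show ?thesis unfolding assignments_def by (simp add: choice_iff)
      qed
      then obtain b where b: "b \<in> assignments L M" by blast
      \<comment> \<open>Disjointness makes the index chosen by \<open>SOME\<close> the only one;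
        variables outside all tuples get a default value from \<open>b\<close>.\<close>
      define c where "c v = (if \<exists>i\<in>I. v \<in> x i then a (SOME i. i \<in> I \<and> v \<in> x i) v else b v)" for v
      have c_eq: "c v = a i v" if "i \<in> I" "v \<in> x i" for i v
      proof -
        have "(SOME i. i \<in> I \<and> v \<in> x i) = i"
          using that disj by (intro some_equality) (auto simp: disjoint_family_on_def)
        then show ?thesis using that by (auto simp: c_def)
      qed
      have c: "c \<in> assignments L M"
        unfolding assignments_def
      proof (intro CollectI allI)
        fix v show "c v \<in> univ M (vsort L v)"
        proof (cases "\<exists>i\<in>I. v \<in> x i")
          case True
          then show ?thesis using c_eq a(1) by (force simp: assignments_def)
        qed (use b in \<open>auto simp: c_def assignments_def\<close>)
      qed
      have "realized_type L M ?x c \<in> C j" if j: "j \<in> J'" for j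
      proof -
        obtain i \<phi> e where [simp]: "j = (i, \<phi>, e)" by (cases j)
        have i: "i \<in> I" and \<phi>: "\<phi> \<in> formulas L M (x i)" "\<phi> \<in> G i"
          using j J'(2) by (auto simp: J_def G_def)
        have "fval L M \<phi> c = fval L M \<phi> (a i)"
          using \<phi>(1) i by (intro fval_cong c_eq) (auto simp: formulas_def)
        then have "\<bar>realized_type L M ?x c \<phi> - q i \<phi>\<bar> < \<delta>"
          using a(2)[OF i \<phi>(2)] \<phi>(1) sub[OF i] by (auto simp: realized_type_def)
        moreover have "\<delta> \<le> e" using \<delta>_le j by simp
        ultimately have "realized_type L M ?x c \<phi> \<in> cball (q i \<phi>) e"
          by (simp add: dist_real_def)
        then show ?thesis
          using realized_type_in_complete_types[OF c] by (simp add: C_def)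
      qed
      then have "realized_type L M ?x c \<in> K" if "K \<in> F" for K
      proof (cases "K = topspace ?S")
        case True
        then show ?thesis using realized_type_in_complete_types[OF c, of ?x] by simp
      next
        case False
        then have "K \<in> C ` J'" using that unfolding J'(3)[symmetric] by blast
        then show ?thesis using \<open>\<And>j. j \<in> J' \<Longrightarrow> realized_type L M ?x c \<in> C j\<close> by blast
      qed
      then show "\<Inter>F \<noteq> {}" by blast
    qed
  qed
  then obtain p where p: "p \<in> topspace ?S" "\<And>j. j \<in> J \<Longrightarrow> p \<in> C j" by blast
  show thesis
  proof (rule that)
    show "p \<in> complete_types L M ?x" using p(1) by simp
    fix i assume i: "i \<in> I"
    have eq: "p \<phi> = q i \<phi>" if "\<phi> \<in> formulas L M (x i)" for \<phi>
    proof -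
      have "dist (q i \<phi>) (p \<phi>) \<le> 0 + e" if "0 < e" for e
        using p(2)[of "(i, \<phi>, e)"] i \<open>\<phi> \<in> formulas L M (x i)\<close> that by (simp add: J_def C_def)
      then have "dist (q i \<phi>) (p \<phi>) \<le> 0" by (rule field_le_epsilon)
      then show ?thesis by simp
    qed
    have "q i \<in> extensional (formulas L M (x i))" using q[OF i] by (simp add: complete_types_def)
    then show "restrict_type L M (x i) p = q i"
      unfolding restrict_type_def
      by (rule extensionalityI[OF restrict_extensional]) (simp add: eq)
  qed
qed

section \<open>Product measures\<close>

text \<open>A finite sum of products allows iterated integration without any product measure: with
  all other coordinates frozen, the sum is a linear combination of functions of one
  variable.\<close>

lemma sum_prod_integral_nonneg:
  fixes \<theta> :: "'i \<Rightarrow> 'j \<Rightarrow> 'a \<Rightarrow> real"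
  assumes I: "finite I"
    and nonempty: "\<And>i. i \<in> I \<Longrightarrow> space (\<mu> i) \<noteq> {}"
    and int: "\<And>i j. i \<in> I \<Longrightarrow> j \<in> J \<Longrightarrow> integrable (\<mu> i) (\<theta> i j)"
    and nonneg: "\<And>q. (\<And>i. i \<in> I \<Longrightarrow> q i \<in> space (\<mu> i)) \<Longrightarrow> 0 \<le> (\<Sum>j\<in>J. \<Prod>i\<in>I. \<theta> i j (q i))"
  shows "0 \<le> (\<Sum>j\<in>J. \<Prod>i\<in>I. integral\<^sup>L (\<mu> i) (\<theta> i j))"
proof -
  have partial: "0 \<le> (\<Sum>j\<in>J. (\<Prod>i\<in>K. integral\<^sup>L (\<mu> i) (\<theta> i j)) * (\<Prod>i\<in>I - K. \<theta> i j (q i)))"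
    if "finite K" "K \<subseteq> I" "\<And>i. i \<in> I \<Longrightarrow> q i \<in> space (\<mu> i)" for K q
    using that
  proof (induction K arbitrary: q rule: finite_induct)
    case empty
    then show ?case using nonneg[of q] by simp
  next
    case (insert k K)
    define A where "A j = (\<Prod>i\<in>K. integral\<^sup>L (\<mu> i) (\<theta> i j))" for j
    define B where "B j = (\<Prod>i\<in>I - insert k K. \<theta> i j (q i))" for j
    have k: "k \<in> I" using insert.prems by blast
    have IK: "I - K = insert k (I - insert k K)" using k insert.hyps by auto
    have split: "(\<Prod>i\<in>I - K. \<theta> i j ((q(k := t)) i)) = \<theta> k j t * B j" for j t
    proof -
      have "(\<Prod>i\<in>I - insert k K. \<theta> i j ((q(k := t)) i)) = B j"
        unfolding B_def by (intro prod.cong) auto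
      then show ?thesis unfolding IK using I by simp
    qed
    have "0 \<le> (\<Sum>j\<in>J. A j * B j * \<theta> k j t)" if "t \<in> space (\<mu> k)" for t
    proof -
      have "0 \<le> (\<Sum>j\<in>J. A j * (\<Prod>i\<in>I - K. \<theta> i j ((q(k := t)) i)))"
        unfolding A_def using insert.prems that by (intro insert.IH) auto
      then show ?thesis unfolding split by (simp add: ac_simps)
    qed
    then have "0 \<le> (\<integral>t. (\<Sum>j\<in>J. A j * B j * \<theta> k j t) \<partial>\<mu> k)"
      by (rule Bochner_Integration.integral_nonneg)
    also have "\<dots> = (\<Sum>j\<in>J. A j * B j * integral\<^sup>L (\<mu> k) (\<theta> k j))"
      using int[OF k] by (subst Bochner_Integration.integral_sum) auto
    also have "\<dots> = (\<Sum>j\<in>J. (\<Prod>i\<in>insert k K. integral\<^sup>L (\<mu> i) (\<theta> i j)) * B j)"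
      using insert.hyps by (simp add: A_def ac_simps)
    finally show ?case by (simp add: B_def)
  qed
  \<comment> \<open>Some point is needed to instantiate the claim, although for \<open>K = I\<close>
    no frozen factor remains.\<close>
  have "\<exists>q. \<forall>i\<in>I. q i \<in> space (\<mu> i)" using nonempty by (intro bchoice) blast
  then obtain q where "\<And>i. i \<in> I \<Longrightarrow> q i \<in> space (\<mu> i)" by blast
  from partial[OF I subset_refl this] show ?thesis by simp
qed

section \<open>Linear structure of sums of products and their values\<close>

lemma sum_append_intervals:
  fixes f g :: "nat \<Rightarrow> 'a::comm_monoid_add"
  shows "(\<Sum>j\<in>{1..m + k}. if j \<le> m then f j else g (j - m)) = sum f {1..m} + sum g {1..k}"
  by (induction k) (auto simp: ac_simps intro: sum.cong)

text \<open>The product functional, as a relation between a sum of products and its value: the value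
  is not obviously independent of the chosen decomposition.\<close>

definition product_value ::
  "('f, 'p, 'v, 's) language \<Rightarrow> ('f, 'p, 's, 'm) mstruct \<Rightarrow> nat \<Rightarrow> (nat \<Rightarrow> 'v set) \<Rightarrow>
   (nat \<Rightarrow> (('f, 'p, 'v, 's, 'm) fm \<Rightarrow> real) measure) \<Rightarrow>
   ((('f, 'p, 'v, 's, 'm) fm \<Rightarrow> real) \<Rightarrow> real) \<Rightarrow> real \<Rightarrow> bool" where
  "product_value L M n x \<mu> \<psi> v \<longleftrightarrow>
     definable_predicate L M (\<Union>i\<in>{1..n}. x i) \<psi> \<and>
     (\<exists>(m::nat) \<theta>.
        (\<forall>i\<in>{1..n}. \<forall>j\<in>{1..m}. definable_predicate L M (x i) (\<theta> i j)) \<and>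
        (\<forall>p\<in>complete_types L M (\<Union>i\<in>{1..n}. x i).
           \<psi> p = (\<Sum>j\<in>{1..m}. \<Prod>i\<in>{1..n}. \<theta> i j (restrict_type L M (x i) p))) \<and>
        v = (\<Sum>j\<in>{1..m}. \<Prod>i\<in>{1..n}. integral\<^sup>L (\<mu> i) (\<theta> i j)))"

lemma product_valueE:
  assumes "product_value L M n x \<mu> \<psi> v"
  obtains m \<theta> where "definable_predicate L M (\<Union>i\<in>{1..n}. x i) \<psi>"
    "\<And>i j. i \<in> {1..n} \<Longrightarrow> j \<in> {1..m::nat} \<Longrightarrow> definable_predicate L M (x i) (\<theta> i j)"
    "\<And>p. p \<in> complete_types L M (\<Union>i\<in>{1..n}. x i) \<Longrightarrow>
      \<psi> p = (\<Sum>j\<in>{1..m}. \<Prod>i\<in>{1..n}. \<theta> i j (restrict_type L M (x i) p))"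
    "v = (\<Sum>j\<in>{1..m}. \<Prod>i\<in>{1..n}. integral\<^sup>L (\<mu> i) (\<theta> i j))"
  using assms unfolding product_value_def
  by (elim conjE exE) (rule that, assumption, blast+)

lemma product_valueI:
  assumes "definable_predicate L M (\<Union>i\<in>{1..n}. x i) \<psi>"
    "\<And>i j. i \<in> {1..n} \<Longrightarrow> j \<in> {1..m::nat} \<Longrightarrow> definable_predicate L M (x i) (\<theta> i j)"
    "\<And>p. p \<in> complete_types L M (\<Union>i\<in>{1..n}. x i) \<Longrightarrow>
      \<psi> p = (\<Sum>j\<in>{1..m}. \<Prod>i\<in>{1..n}. \<theta> i j (restrict_type L M (x i) p))"
    "v = (\<Sum>j\<in>{1..m}. \<Prod>i\<in>{1..n}. integral\<^sup>L (\<mu> i) (\<theta> i j))"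
  shows "product_value L M n x \<mu> \<psi> v"
  using assms unfolding product_value_def by blast

lemma sum_of_products_iff_product_value:
  "definable_predicate L M (\<Union>i\<in>{1..n}. x i) \<psi> \<and> sum_of_products L M n x \<psi> \<longleftrightarrow>
   (\<exists>v. product_value L M n x \<mu> \<psi> v)"
  unfolding product_value_def sum_of_products_def by blast

lemma product_value_add:
  assumes "product_value L M n x \<mu> \<psi> v" "product_value L M n x \<mu> \<psi>' v'"
  shows "product_value L M n x \<mu> (\<lambda>p. \<psi> p + \<psi>' p) (v + v')"
proof -
  let ?X = "\<Union>i\<in>{1..n}. x i"
  obtain m \<theta> where 1: "definable_predicate L M ?X \<psi>"
    "\<And>i j. i \<in> {1..n} \<Longrightarrow> j \<in> {1..m::nat} \<Longrightarrow> definable_predicate L M (x i) (\<theta> i j)"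
    "\<And>p. p \<in> complete_types L M ?X \<Longrightarrow>
      \<psi> p = (\<Sum>j\<in>{1..m}. \<Prod>i\<in>{1..n}. \<theta> i j (restrict_type L M (x i) p))"
    "v = (\<Sum>j\<in>{1..m}. \<Prod>i\<in>{1..n}. integral\<^sup>L (\<mu> i) (\<theta> i j))"
    using assms(1) by (rule product_valueE) blast
  obtain m' \<theta>' where 2: "definable_predicate L M ?X \<psi>'"
    "\<And>i j. i \<in> {1..n} \<Longrightarrow> j \<in> {1..m'::nat} \<Longrightarrow> definable_predicate L M (x i) (\<theta>' i j)"
    "\<And>p. p \<in> complete_types L M ?X \<Longrightarrow>
      \<psi>' p = (\<Sum>j\<in>{1..m'}. \<Prod>i\<in>{1..n}. \<theta>' i j (restrict_type L M (x i) p))"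
    "v' = (\<Sum>j\<in>{1..m'}. \<Prod>i\<in>{1..n}. integral\<^sup>L (\<mu> i) (\<theta>' i j))"
    using assms(2) by (rule product_valueE) blast
  define \<eta> where "\<eta> i j = (if j \<le> m then \<theta> i j else \<theta>' i (j - m))" for i j
  \<comment> \<open>Stated for arbitrary \<open>F\<close> because the concatenated family is used
    twice: with \<open>F i\<close> evaluation at a restricted type, and with \<open>F i\<close>
    integration against \<open>\<mu> i\<close>.\<close>
  have sum: "(\<Sum>j\<in>{1..m + m'}. \<Prod>i\<in>{1..n}. F i (\<eta> i j)) =
      (\<Sum>j\<in>{1..m}. \<Prod>i\<in>{1..n}. F i (\<theta> i j)) + (\<Sum>j\<in>{1..m'}. \<Prod>i\<in>{1..n}. F i (\<theta>' i j))"
    for F :: "nat \<Rightarrow> _ \<Rightarrow> real"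
  proof -
    have "(\<Sum>j\<in>{1..m + m'}. \<Prod>i\<in>{1..n}. F i (\<eta> i j)) =
      (\<Sum>j\<in>{1..m + m'}. if j \<le> m then \<Prod>i\<in>{1..n}. F i (\<theta> i j) else \<Prod>i\<in>{1..n}. F i (\<theta>' i (j - m)))"
      by (intro sum.cong) (auto simp: \<eta>_def)
    then show ?thesis
      using sum_append_intervals[where m = m and k = m' and f = "\<lambda>j. \<Prod>i\<in>{1..n}. F i (\<theta> i j)"
          and g = "\<lambda>j. \<Prod>i\<in>{1..n}. F i (\<theta>' i j)"]
      by simp
  qed
  show ?thesis
  proof (rule product_valueI[where m = "m + m'" and \<theta> = \<eta>])
    show "definable_predicate L M ?X (\<lambda>p. \<psi> p + \<psi>' p)"
      using 1(1) 2(1) unfolding definable_predicate_def by (rule continuous_map_add)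
    show "definable_predicate L M (x i) (\<eta> i j)" if "i \<in> {1..n}" "j \<in> {1..m + m'}" for i j
      using that by (auto simp: \<eta>_def intro!: 1(2) 2(2))
    show "\<psi> p + \<psi>' p = (\<Sum>j\<in>{1..m + m'}. \<Prod>i\<in>{1..n}. \<eta> i j (restrict_type L M (x i) p))"
      if "p \<in> complete_types L M ?X" for p
      unfolding 1(3)[OF that] 2(3)[OF that]
      using sum[of "\<lambda>i h. h (restrict_type L M (x i) p)"] by simp
    show "v + v' = (\<Sum>j\<in>{1..m + m'}. \<Prod>i\<in>{1..n}. integral\<^sup>L (\<mu> i) (\<eta> i j))"
      unfolding 1(4) 2(4) using sum[of "\<lambda>i. integral\<^sup>L (\<mu> i)"] by simp
  qed
qed

text \<open>The scalar has to be absorbed into one factor of each product, so at least one factor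
  must be there. For \<open>n = 0\<close> every product is 1, and sums of products would only be
  natural numbers.\<close>

lemma product_value_scale:
  assumes n: "1 \<le> n" and "product_value L M n x \<mu> \<psi> v"
  shows "product_value L M n x \<mu> (\<lambda>p. c * \<psi> p) (c * v)"
proof -
  let ?X = "\<Union>i\<in>{1..n}. x i"
  obtain m \<theta> where 1: "definable_predicate L M ?X \<psi>"
    "\<And>i j. i \<in> {1..n} \<Longrightarrow> j \<in> {1..m::nat} \<Longrightarrow> definable_predicate L M (x i) (\<theta> i j)"
    "\<And>p. p \<in> complete_types L M ?X \<Longrightarrow>
      \<psi> p = (\<Sum>j\<in>{1..m}. \<Prod>i\<in>{1..n}. \<theta> i j (restrict_type L M (x i) p))"
    "v = (\<Sum>j\<in>{1..m}. \<Prod>i\<in>{1..n}. integral\<^sup>L (\<mu> i) (\<theta> i j))"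
    using assms(2) by (rule product_valueE) blast
  \<comment> \<open>The family of scalars that is \<open>c\<close> in the first factor and 1
    elsewhere, so that its product is \<open>c\<close>.\<close>
  define d where "d i = (if i = 1 then c else 1)" for i :: nat
  have "(\<Prod>i\<in>{1..n}. d i) = c" using n by (simp add: d_def prod.delta)
  then have prod: "(\<Prod>i\<in>{1..n}. d i * f i) = c * (\<Prod>i\<in>{1..n}. f i)" for f
    by (simp add: prod.distrib)
  show ?thesis
  proof (rule product_valueI[where m = m and \<theta> = "\<lambda>i j q. d i * \<theta> i j q"])
    show "definable_predicate L M ?X (\<lambda>p. c * \<psi> p)"
      using 1(1) unfolding definable_predicate_def by (rule continuous_map_real_mult_left)
    show "definable_predicate L M (x i) (\<lambda>q. d i * \<theta> i j q)" if "i \<in> {1..n}" "j \<in> {1..m}" for i j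
      using 1(2)[OF that] unfolding definable_predicate_def by (rule continuous_map_real_mult_left)
    show "c * \<psi> p = (\<Sum>j\<in>{1..m}. \<Prod>i\<in>{1..n}. d i * \<theta> i j (restrict_type L M (x i) p))"
      if "p \<in> complete_types L M ?X" for p
      unfolding 1(3)[OF that] prod by (rule sum_distrib_left)
    show "c * v = (\<Sum>j\<in>{1..m}. \<Prod>i\<in>{1..n}. integral\<^sup>L (\<mu> i) (\<lambda>q. d i * \<theta> i j q))"
      unfolding 1(4) integral_mult_right_zero prod by (rule sum_distrib_left)
  qed
qed

lemma product_value_prod:
  assumes "\<And>i. i \<in> {1..n} \<Longrightarrow> definable_predicate L M (x i) (\<psi> i)"
  shows "product_value L M n x \<mu> (\<lambda>p. \<Prod>i\<in>{1..n}. \<psi> i (restrict_type L M (x i) p))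
    (\<Prod>i\<in>{1..n}. integral\<^sup>L (\<mu> i) (\<psi> i))"
proof (rule product_valueI[where m = 1 and \<theta> = "\<lambda>i j. \<psi> i"])
  have "cont_real (type_space L M (\<Union>i\<in>{1..n}. x i)) (\<lambda>p. \<psi> i (restrict_type L M (x i) p))"
    if "i \<in> {1..n}" for i
    using that assms by (intro cont_real_compose_restrict_type) auto
  then show "definable_predicate L M (\<Union>i\<in>{1..n}. x i)
      (\<lambda>p. \<Prod>i\<in>{1..n}. \<psi> i (restrict_type L M (x i) p))"
    unfolding definable_predicate_def by (intro continuous_map_prod) auto
qed (use assms in auto)

lemma keisler_measures_integrable:
  assumes "metric_structure L M" "\<mu> \<in> keisler_measures L M x" "definable_predicate L M x \<psi>"
  shows "integrable \<mu> \<psi>"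
  using assms regular_Borel_probability_integrable[OF compact_type_space]
  by (auto simp: keisler_measures_def definable_predicate_def)

lemma keisler_measures_prob_space:
  assumes "\<mu> \<in> keisler_measures L M x"
  shows "prob_space \<mu>" "space \<mu> = complete_types L M x"
  using assms by (auto simp: keisler_measures_def regular_Borel_probability_def)

lemma product_value_nonneg:
  assumes M: "metric_structure L M" and disj: "disjoint_family_on x {1..n}"
    and \<mu>: "\<And>i. i \<in> {1..n} \<Longrightarrow> \<mu> i \<in> keisler_measures L M (x i)"
    and "product_value L M n x \<mu> \<psi> v"
    and nonneg: "\<And>p. p \<in> complete_types L M (\<Union>i\<in>{1..n}. x i) \<Longrightarrow> 0 \<le> \<psi> p"
  shows "0 \<le> v"
proof -
  let ?X = "\<Union>i\<in>{1..n}. x i"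
  obtain m \<theta> where 1: "definable_predicate L M ?X \<psi>"
    "\<And>i j. i \<in> {1..n} \<Longrightarrow> j \<in> {1..m::nat} \<Longrightarrow> definable_predicate L M (x i) (\<theta> i j)"
    "\<And>p. p \<in> complete_types L M ?X \<Longrightarrow>
      \<psi> p = (\<Sum>j\<in>{1..m}. \<Prod>i\<in>{1..n}. \<theta> i j (restrict_type L M (x i) p))"
    "v = (\<Sum>j\<in>{1..m}. \<Prod>i\<in>{1..n}. integral\<^sup>L (\<mu> i) (\<theta> i j))"
    using assms(4) by (rule product_valueE) blast
  show ?thesis
    unfolding 1(4)
  proof (rule sum_prod_integral_nonneg)
    show "space (\<mu> i) \<noteq> {}" if "i \<in> {1..n}" for i
      using keisler_measures_prob_space(1)[OF \<mu>[OF that]] by (rule prob_space.not_empty)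
    show "integrable (\<mu> i) (\<theta> i j)" if "i \<in> {1..n}" "j \<in> {1..m}" for i j
      using M \<mu>[OF that(1)] 1(2)[OF that] by (rule keisler_measures_integrable)
    fix q assume "\<And>i. i \<in> {1..n} \<Longrightarrow> q i \<in> space (\<mu> i)"
    then have "q i \<in> complete_types L M (x i)" if "i \<in> {1..n}" for i
      using keisler_measures_prob_space(2)[OF \<mu>[OF that]] that by blast
    \<comment> \<open>Nonnegativity is known only at joint types, whereas the iterated integration
      tests independently chosen types; a common extension connects the two.\<close>
    then obtain p where p: "p \<in> complete_types L M ?X"
      "\<And>i. i \<in> {1..n} \<Longrightarrow> restrict_type L M (x i) p = q i"
      using restrict_type_jointly_surj[OF M _ disj, of q] by blast
    have "\<psi> p = (\<Sum>j\<in>{1..m}. \<Prod>i\<in>{1..n}. \<theta> i j (q i))"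
      unfolding 1(3)[OF p(1)] using p(2) by (intro sum.cong prod.cong) auto
    then show "0 \<le> (\<Sum>j\<in>{1..m}. \<Prod>i\<in>{1..n}. \<theta> i j (q i))" using nonneg[OF p(1)] by simp
  qed simp
qed

text \<open>Linearity of the integral carries the condition from single products to sums, and a
  single product is a sum with one term. This turns product measures into the solutions of a moment
  problem.\<close>

lemma product_measure_iff_product_value:
  assumes M: "metric_structure L M"
  shows "product_measure L M n x \<mu> \<omega> \<longleftrightarrow>
    regular_Borel_probability (type_space L M (\<Union>i\<in>{1..n}. x i)) \<omega> \<and>
    (\<forall>\<psi> v. product_value L M n x \<mu> \<psi> v \<longrightarrow> integral\<^sup>L \<omega> \<psi> = v)"
    (is "_ \<longleftrightarrow> ?reg \<and> ?val")
proof
  let ?X = "\<Union>i\<in>{1..n}. x i"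
  assume \<omega>: "product_measure L M n x \<mu> \<omega>"
  then have K: "\<omega> \<in> keisler_measures L M ?X" by (simp add: product_measure_def)
  have "integral\<^sup>L \<omega> \<psi> = v" if \<psi>: "product_value L M n x \<mu> \<psi> v" for \<psi> v
  proof -
    obtain m \<theta> where 1: "definable_predicate L M ?X \<psi>"
      "\<And>i j. i \<in> {1..n} \<Longrightarrow> j \<in> {1..m::nat} \<Longrightarrow> definable_predicate L M (x i) (\<theta> i j)"
      "\<And>p. p \<in> complete_types L M ?X \<Longrightarrow>
        \<psi> p = (\<Sum>j\<in>{1..m}. \<Prod>i\<in>{1..n}. \<theta> i j (restrict_type L M (x i) p))"
      "v = (\<Sum>j\<in>{1..m}. \<Prod>i\<in>{1..n}. integral\<^sup>L (\<mu> i) (\<theta> i j))"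
      using \<psi> by (rule product_valueE) blast
    let ?P = "\<lambda>j p. \<Prod>i\<in>{1..n}. \<theta> i j (restrict_type L M (x i) p)"
    have "integral\<^sup>L \<omega> \<psi> = (\<integral>p. (\<Sum>j\<in>{1..m}. ?P j p) \<partial>\<omega>)"
      using 1(3) keisler_measures_prob_space(2)[OF K] by (intro Bochner_Integration.integral_cong) auto
    also have "\<dots> = (\<Sum>j\<in>{1..m}. integral\<^sup>L \<omega> (?P j))"
    proof (rule Bochner_Integration.integral_sum)
      fix j assume "j \<in> {1..m}"
      then have "product_value L M n x \<mu> (?P j) (\<Prod>i\<in>{1..n}. integral\<^sup>L (\<mu> i) (\<theta> i j))"
        using 1(2) by (intro product_value_prod)
      then show "integrable \<omega> (?P j)"
        using keisler_measures_integrable[OF M K] by (simp add: product_value_def)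
    qed
    also have "\<dots> = v"
      unfolding 1(4)
    proof (rule sum.cong[OF refl])
      fix j assume "j \<in> {1..m}"
      then have "\<forall>i\<in>{1..n}. definable_predicate L M (x i) (\<theta> i j)" using 1(2) by blast
      moreover have "\<forall>\<psi>. (\<forall>i\<in>{1..n}. definable_predicate L M (x i) (\<psi> i)) \<longrightarrow>
          (\<integral>p. (\<Prod>i\<in>{1..n}. \<psi> i (restrict_type L M (x i) p)) \<partial>\<omega>) = (\<Prod>i\<in>{1..n}. \<integral>q. \<psi> i q \<partial>\<mu> i)"
        using \<omega> by (simp add: product_measure_def)
      ultimately show "integral\<^sup>L \<omega> (?P j) = (\<Prod>i\<in>{1..n}. integral\<^sup>L (\<mu> i) (\<theta> i j))"
        by (elim allE[of _ "\<lambda>i. \<theta> i j"]) blast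
    qed
    finally show ?thesis .
  qed
  then show "?reg \<and> ?val" using K by (simp add: keisler_measures_def)
next
  assume val: "?reg \<and> ?val"
  show "product_measure L M n x \<mu> \<omega>"
    unfolding product_measure_def
  proof (intro conjI allI impI)
    show "\<omega> \<in> keisler_measures L M (\<Union>i\<in>{1..n}. x i)" using val by (simp add: keisler_measures_def)
    fix \<psi> assume "\<forall>i\<in>{1..n}. definable_predicate L M (x i) (\<psi> i)"
    then have "product_value L M n x \<mu> (\<lambda>p. \<Prod>i\<in>{1..n}. \<psi> i (restrict_type L M (x i) p))
        (\<Prod>i\<in>{1..n}. integral\<^sup>L (\<mu> i) (\<psi> i))"
      by (intro product_value_prod) blast
    then show "(\<integral>p. (\<Prod>i\<in>{1..n}. \<psi> i (restrict_type L M (x i) p)) \<partial>\<omega>) =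
        (\<Prod>i\<in>{1..n}. \<integral>q. \<psi> i q \<partial>\<mu> i)"
      using val by blast
  qed
qed

theorem corollary1p1:
  fixes L :: "('f, 'p, 'v, 's) language"
    and T :: "('f, 'p, 'v, 's, 'm) fm set"
    and M :: "('f, 'p, 's, 'm) mstruct"
    and n :: nat
    and x :: "nat \<Rightarrow> 'v set"
    and \<mu> :: "nat \<Rightarrow> (('f, 'p, 'v, 's, 'm) fm \<Rightarrow> real) measure"
  assumes "wf_language L"
    and "complete_theory L T"
    and "metric_structure L M" and "models L M T"
    and "1 \<le> n"
    and "disjoint_family_on x {1..n}"
    and "\<forall>i\<in>{1..n}. \<mu> i \<in> keisler_measures L M (x i)"
  shows "weakly_orthogonal L M n x \<mu> \<longleftrightarrow>
    (\<forall>\<phi> \<epsilon>. definable_predicate L M (\<Union>i\<in>{1..n}. x i) \<phi> \<and> (0::real) < \<epsilon> \<longrightarrow>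
      (\<exists>\<psi>\<^sub>m \<psi>\<^sub>p.
         definable_predicate L M (\<Union>i\<in>{1..n}. x i) \<psi>\<^sub>m \<and> sum_of_products L M n x \<psi>\<^sub>m \<and>
         definable_predicate L M (\<Union>i\<in>{1..n}. x i) \<psi>\<^sub>p \<and> sum_of_products L M n x \<psi>\<^sub>p \<and>
         (\<forall>p\<in>complete_types L M (\<Union>i\<in>{1..n}. x i). \<psi>\<^sub>m p \<le> \<phi> p \<and> \<phi> p \<le> \<psi>\<^sub>p p) \<and>
         (\<forall>\<omega>. product_measure L M n x \<mu> \<omega> \<longrightarrow> (\<integral>p. (\<psi>\<^sub>p p - \<psi>\<^sub>m p) \<partial>\<omega>) \<le> \<epsilon>)))"
proof -
  let ?X = "\<Union>i\<in>{1..n}. x i"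
  let ?R = "product_value L M n x \<mu>"
  note M = assms(3)
  have \<mu>: "\<mu> i \<in> keisler_measures L M (x i)" if "i \<in> {1..n}" for i using assms(7) that by blast
  have one: "?R (\<lambda>_. 1) 1"
  proof -
    have "integral\<^sup>L (\<mu> i) (\<lambda>_. 1) = (1::real)" if "i \<in> {1..n}" for i
    proof -
      interpret prob_space "\<mu> i" using \<mu>[OF that] by (rule keisler_measures_prob_space)
      show ?thesis by (simp add: prob_space)
    qed
    then show ?thesis
      using product_value_prod[of n L M x "\<lambda>_ _. 1" \<mu>] by (simp add: definable_predicate_def)
  qed
  interpret R: positive_moment_problem "type_space L M ?X" ?R
  proof
    show "compact_space (type_space L M ?X)" using M by (rule compact_type_space)
    show "Hausdorff_space (type_space L M ?X)" by (rule Hausdorff_type_space)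
    show "cont_real (type_space L M ?X) \<psi>" if "?R \<psi> v" for \<psi> v
      using that by (simp add: product_value_def definable_predicate_def)
    show "0 \<le> v" if "?R \<psi> v" "\<And>p. p \<in> topspace (type_space L M ?X) \<Longrightarrow> 0 \<le> \<psi> p" for \<psi> v
      using product_value_nonneg[OF M assms(6) \<mu> that(1)] that(2) by simp
  qed (use one assms(5) product_value_add product_value_scale in auto)
  have sol: "R.solution = product_measure L M n x \<mu>"
    unfolding fun_eq_iff R.solution_def product_measure_iff_product_value[OF M] by blast
  have diff: "(\<integral>p. (\<psi>\<^sub>p p - \<psi>\<^sub>m p) \<partial>\<omega>) = v\<^sub>p - v\<^sub>m"
    if "product_measure L M n x \<mu> \<omega>" "?R \<psi>\<^sub>m v\<^sub>m" "?R \<psi>\<^sub>p v\<^sub>p" for \<omega> \<psi>\<^sub>m v\<^sub>m \<psi>\<^sub>p v\<^sub>p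
    using R.add[OF that(3) R.minus[OF that(2)]] that(1)
    by (simp add: product_measure_iff_product_value[OF M])
  \<comment> \<open>A witness is needed to draw any conclusion from a bound that is assumed for all
    product measures.\<close>
  obtain \<omega>\<^sub>0 where \<omega>\<^sub>0: "product_measure L M n x \<mu> \<omega>\<^sub>0"
    using R.solution_exists sol by auto
  \<comment> \<open>By \<open>diff\<close> the integral in (2) is the same number for every product
    measure, so condition (2) amounts to a bound on the difference of the two values; the direction
    from integrals to values evaluates it at \<open>\<omega>\<^sub>0\<close>.\<close>
  have value_bound: "(\<exists>v\<^sub>m v\<^sub>p. ?R \<psi>\<^sub>m v\<^sub>m \<and> ?R \<psi>\<^sub>p v\<^sub>p \<and> v\<^sub>p - v\<^sub>m \<le> \<epsilon>) \<longleftrightarrow>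
      (\<exists>v. ?R \<psi>\<^sub>m v) \<and> (\<exists>v. ?R \<psi>\<^sub>p v) \<and>
      (\<forall>\<omega>. product_measure L M n x \<mu> \<omega> \<longrightarrow> (\<integral>p. (\<psi>\<^sub>p p - \<psi>\<^sub>m p) \<partial>\<omega>) \<le> \<epsilon>)"
    for \<psi>\<^sub>m \<psi>\<^sub>p \<epsilon>
  proof (intro iffI; elim exE conjE)
    fix v\<^sub>m v\<^sub>p assume "?R \<psi>\<^sub>m v\<^sub>m" "?R \<psi>\<^sub>p v\<^sub>p" "v\<^sub>p - v\<^sub>m \<le> \<epsilon>"
    then show "(\<exists>v. ?R \<psi>\<^sub>m v) \<and> (\<exists>v. ?R \<psi>\<^sub>p v) \<and>
      (\<forall>\<omega>. product_measure L M n x \<mu> \<omega> \<longrightarrow> (\<integral>p. (\<psi>\<^sub>p p - \<psi>\<^sub>m p) \<partial>\<omega>) \<le> \<epsilon>)"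
      using diff by auto
  next
    fix v\<^sub>m v\<^sub>p assume v: "?R \<psi>\<^sub>m v\<^sub>m" "?R \<psi>\<^sub>p v\<^sub>p"
      and "\<forall>\<omega>. product_measure L M n x \<mu> \<omega> \<longrightarrow> (\<integral>p. (\<psi>\<^sub>p p - \<psi>\<^sub>m p) \<partial>\<omega>) \<le> \<epsilon>"
    then have "v\<^sub>p - v\<^sub>m \<le> \<epsilon>" using diff[OF \<omega>\<^sub>0 v] \<omega>\<^sub>0 by auto
    then show "\<exists>v\<^sub>m v\<^sub>p. ?R \<psi>\<^sub>m v\<^sub>m \<and> ?R \<psi>\<^sub>p v\<^sub>p \<and> v\<^sub>p - v\<^sub>m \<le> \<epsilon>" using v by blast
  qed
  have "weakly_orthogonal L M n x \<mu> \<longleftrightarrow> (\<exists>!\<omega>. R.solution \<omega>)"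
    unfolding weakly_orthogonal_def sol ..
  also have "\<dots> \<longleftrightarrow> (\<forall>\<phi> \<epsilon>. definable_predicate L M ?X \<phi> \<and> 0 < \<epsilon> \<longrightarrow>
      (\<exists>\<psi>\<^sub>m \<psi>\<^sub>p. (\<exists>v\<^sub>m v\<^sub>p. ?R \<psi>\<^sub>m v\<^sub>m \<and> ?R \<psi>\<^sub>p v\<^sub>p \<and> v\<^sub>p - v\<^sub>m \<le> \<epsilon>) \<and>
         (\<forall>p\<in>complete_types L M ?X. \<psi>\<^sub>m p \<le> \<phi> p \<and> \<phi> p \<le> \<psi>\<^sub>p p)))"
    unfolding R.unique_solution_iff definable_predicate_def topspace_type_space by blast
  also have "\<dots> \<longleftrightarrow> (\<forall>\<phi> \<epsilon>. definable_predicate L M ?X \<phi> \<and> 0 < \<epsilon> \<longrightarrow>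
      (\<exists>\<psi>\<^sub>m \<psi>\<^sub>p.
         definable_predicate L M ?X \<psi>\<^sub>m \<and> sum_of_products L M n x \<psi>\<^sub>m \<and>
         definable_predicate L M ?X \<psi>\<^sub>p \<and> sum_of_products L M n x \<psi>\<^sub>p \<and>
         (\<forall>p\<in>complete_types L M ?X. \<psi>\<^sub>m p \<le> \<phi> p \<and> \<phi> p \<le> \<psi>\<^sub>p p) \<and>
         (\<forall>\<omega>. product_measure L M n x \<mu> \<omega> \<longrightarrow> (\<integral>p. (\<psi>\<^sub>p p - \<psi>\<^sub>m p) \<partial>\<omega>) \<le> \<epsilon>)))"
    unfolding value_bound sum_of_products_iff_product_value[where \<mu> = \<mu>, symmetric]
    by (simp only: conj_ac)
  finally show ?thesis .
qed

end
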